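(* Let $\alpha$ be a real, positive algebraic number, and let $h$ be the order of the torsion subgroup of the multiplicative group of the splitting field (over $\mathbb{Q}$) of the minimal polynomial of $\alpha$. Then $\mathrm{Tr}_{\mathbb{Q}(\alpha)/\mathbb{Q}}(\alpha^n)=0$ for infinitely many $n\in\mathbb{N}$ if and only if $\alpha\notin\mathbb{Q}(\alpha^h)$.
   Context: $\mathbb{N}$ denotes the non-negative integers. *)

theory Defs
  imports Complex_Main "HOL-Computational_Algebra.Computational_Algebra"
begin

definition is_subfield :: "'a::field_char_0 set \<Rightarrow> bool" where
  "is_subfield K \<longleftrightarrow> 0 \<in> K \<and> 1 \<in> K \<and>
     (\<forall>x\<in>K. \<forall>y\<in>K. x + y \<in> K \<and> x * y \<in> K) \<and>
     (\<forall>x\<in>K. - x \<in> K \<and> inverse x \<in> K)"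

(* The field Q(S).  Every subfield of a field of characteristic 0 contains Q. *)
definition rat_adjoin :: "'a::field_char_0 set \<Rightarrow> 'a set" where
  "rat_adjoin S = \<Inter>{K. is_subfield K \<and> S \<subseteq> K}"

(* Every field of characteristic 0 as a vector space over Q. *)
interpretation rat_vs: vector_space "\<lambda>q x. (of_rat q :: 'a::field_char_0) * x"
  by unfold_locales (auto simp: algebra_simps of_rat_add of_rat_mult)

(* The trace from K to Q: the trace of the Q-linear map given by multiplication by x on K.
   The diagonal matrix entries are taken with respect to some basis of K over Q; the value does
   not depend on that basis, see field_trace_basis. *)
definition field_trace :: "'a::field_char_0 set \<Rightarrow> 'a \<Rightarrow> rat" where
  "field_trace K x =
     (let B = (SOME B. rat_vs.independent B \<and> rat_vs.span B = K)
      in \<Sum>b\<in>B. rat_vs.representation B (x * b) b)"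

lemma field_trace_basis:
  fixes K :: "'a::field_char_0 set"
  assumes fin: "finite B" and ind: "rat_vs.independent B" and span: "rat_vs.span B = K"
    and closed: "\<And>y. y \<in> K \<Longrightarrow> x * y \<in> K"
  shows "field_trace K x = (\<Sum>b\<in>B. rat_vs.representation B (x * b) b)"
proof -
  define C where "C = (SOME C. rat_vs.independent C \<and> rat_vs.span C = K)"
  have C: "rat_vs.independent C" "rat_vs.span C = K"
    unfolding atomize_conj C_def by (rule someI[of _ B]) (use ind span in auto)
  have finC: "finite C"
    using rat_vs.independent_span_bound[OF fin C(1)] C(2) span rat_vs.span_superset by metis
  have exp: "(\<Sum>d\<in>D. of_rat (rat_vs.representation D v d) * d) = v"
    if "finite D" "rat_vs.independent D" "rat_vs.span D = K" "v \<in> K" for D v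
    using rat_vs.sum_representation_eq[of D v D] that by auto
  have inB: "b \<in> K" if "b \<in> B" for b using that span rat_vs.span_base by blast
  have inC: "c \<in> K" if "c \<in> C" for c using that C rat_vs.span_base by blast
  have rep: "rat_vs.representation D (\<Sum>e\<in>E. of_rat (k e) * v e) d
      = (\<Sum>e\<in>E. k e * rat_vs.representation D (v e) d)"
    if "rat_vs.independent D" "rat_vs.span D = K" "\<And>e. e \<in> E \<Longrightarrow> v e \<in> K"
    for D :: "'a set" and E :: "'a set" and k v d
  proof -
    have "rat_vs.representation D (\<Sum>e\<in>E. of_rat (k e) * v e) d
        = (\<Sum>e\<in>E. rat_vs.representation D (of_rat (k e) * v e) d)"
      by (subst rat_vs.representation_sum) (use that in \<open>auto intro: rat_vs.span_scale\<close>)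
    also have "\<dots> = (\<Sum>e\<in>E. k e * rat_vs.representation D (v e) d)"
      by (rule sum.cong) (use that in \<open>auto simp: rat_vs.representation_scale\<close>)
    finally show ?thesis .
  qed
  let ?rB = "rat_vs.representation B" and ?rC = "rat_vs.representation C"
  have "(\<Sum>b\<in>B. ?rB (x * b) b) = (\<Sum>b\<in>B. \<Sum>c\<in>C. ?rC b c * ?rB (x * c) b)"
  proof (rule sum.cong)
    fix b assume b: "b \<in> B"
    have "x * b = (\<Sum>c\<in>C. of_rat (?rC b c) * (x * c))"
      by (subst exp[OF finC C inB[OF b], symmetric]) (simp add: sum_distrib_left mult_ac)
    thus "?rB (x * b) b = (\<Sum>c\<in>C. ?rC b c * ?rB (x * c) b)"
      using rep[OF ind span, of C "\<lambda>c. x * c"] closed inC by simp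
  qed simp
  also have "\<dots> = (\<Sum>c\<in>C. \<Sum>b\<in>B. ?rB (x * c) b * ?rC b c)"
    by (subst sum.swap) (simp add: mult_ac)
  also have "\<dots> = (\<Sum>c\<in>C. ?rC (x * c) c)"
  proof (rule sum.cong)
    fix c assume c: "c \<in> C"
    have "x * c = (\<Sum>b\<in>B. of_rat (?rB (x * c) b) * b)"
      using exp[OF fin ind span closed[OF inC[OF c]]] by simp
    thus "(\<Sum>b\<in>B. ?rB (x * c) b * ?rC b c) = ?rC (x * c) c"
      using rep[OF C, of B "\<lambda>b. b" "?rB (x * c)" c] inB by simp
  qed simp
  finally show ?thesis
    unfolding field_trace_def Let_def C_def[symmetric] by simp
qed

definition rat_min_poly :: "'a::field_char_0 \<Rightarrow> rat poly" where
  "rat_min_poly x =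
     (THE p. lead_coeff p = 1 \<and> irreducible p \<and> poly (map_poly of_rat p) x = 0)"

(* The splitting field of p over Q inside the complex numbers. *)
definition splitting_field :: "rat poly \<Rightarrow> complex set" where
  "splitting_field p = rat_adjoin {z. poly (map_poly of_rat p) z = 0}"

(* The torsion subgroup of the multiplicative group of K, i.e. the roots of unity in K. *)
definition torsion_units :: "'a::field_char_0 set \<Rightarrow> 'a set" where
  "torsion_units K = {x \<in> K - {0}. \<exists>m::nat. m > 0 \<and> x ^ m = 1}"

end

theory Submission
  imports Defs
begin

text \<open>The trace of \<open>\<alpha> ^ n\<close> is the power sum \<open>\<Sum>z. z ^ n\<close> over the conjugates \<open>z\<close> of \<open>\<alpha>\<close>. If it
  vanishes infinitely often, then by the Skolem--Mahler--Lech theorem it vanishes on a progression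
  \<open>a + N * k\<close>, so the sum of \<open>z ^ a\<close> over all conjugates \<open>z\<close> with \<open>z ^ N = \<alpha> ^ N\<close> is zero. For such \<open>z\<close>
  the quotient \<open>z / \<alpha>\<close> is a root of unity in the splitting field, so \<open>z ^ h = \<alpha> ^ h\<close>; if \<open>\<alpha>\<close> lies in
  \<open>\<rat>(\<alpha> ^ h)\<close>, this forces \<open>z = \<alpha>\<close> and hence \<open>\<alpha> ^ a = 0\<close>, a contradiction. Conversely, if \<open>\<alpha>\<close> is not in
  \<open>\<rat>(\<alpha> ^ h)\<close>, then the minimal polynomial of \<open>\<alpha>\<close> is a polynomial in \<open>X ^ e\<close> for some \<open>e > 1\<close>, so the
  conjugates are permuted by multiplication with \<open>e\<close>-th roots of unity and the power sums vanish
  for all \<open>n\<close> not divisible by \<open>e\<close>.\<close>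

section \<open>Polynomials over a subring\<close>

text \<open>Skolem--Mahler--Lech usually rests on p-adic analysis. Here the roots stay in the
  ambient field, and Hansel's argument runs over the rationals with denominator prime to
  \<open>p\<close>: each quantity attached to a root \<open>z\<close> is a polynomial over
  \<open>zloc p\<close> evaluated at \<open>z\<close>, and summing over all roots lands in
  \<open>zloc p\<close> again. This integrality and the passage from traces to power sums come from
  one fact, the trace of a multiplication map computed in two bases.

  The converse needs \<open>h > 0\<close>: \<open>card\<close> of an infinite set is 0, and then
  \<alpha> ^ h = 1. Hence much of the work goes into showing that the splitting field has only
  finitely many roots of unity.

  The existence of \<open>e\<close> depends on \<alpha> being real and positive: absolute values
  turn the constant coefficient of a minimal polynomial into a power of \<alpha>.\<close>

definition subring_of :: "'a::comm_ring_1 set \<Rightarrow> bool" where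
  "subring_of S \<longleftrightarrow> 0 \<in> S \<and> 1 \<in> S \<and> (\<forall>x\<in>S. \<forall>y\<in>S. x + y \<in> S \<and> x * y \<in> S) \<and> (\<forall>x\<in>S. - x \<in> S)"

text \<open>Coefficient rings are sets in one ambient ring, so the same polynomial can be read over
  \<open>zloc p\<close>, \<rat> or a subfield without changing its type.\<close>

definition poly_over :: "'a::comm_ring_1 set \<Rightarrow> 'a poly set" where
  "poly_over S = {P. \<forall>i. coeff P i \<in> S}"

lemma subring_ofD:
  assumes "subring_of S"
  shows "0 \<in> S" "1 \<in> S" "x \<in> S \<Longrightarrow> y \<in> S \<Longrightarrow> x + y \<in> S" "x \<in> S \<Longrightarrow> y \<in> S \<Longrightarrow> x * y \<in> S"
    "x \<in> S \<Longrightarrow> - x \<in> S" "x \<in> S \<Longrightarrow> y \<in> S \<Longrightarrow> x - y \<in> S"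
proof -
  show "x \<in> S \<Longrightarrow> y \<in> S \<Longrightarrow> x - y \<in> S"
    using assms unfolding subring_of_def by (metis diff_conv_add_uminus)
qed (use assms in \<open>auto simp: subring_of_def\<close>)

lemma subring_of_sum: "subring_of S \<Longrightarrow> (\<And>i. i \<in> I \<Longrightarrow> f i \<in> S) \<Longrightarrow> (\<Sum>i\<in>I. f i) \<in> S"
  by (induction I rule: infinite_finite_induct) (auto simp: subring_ofD)

lemma subring_of_prod: "subring_of S \<Longrightarrow> (\<And>i. i \<in> I \<Longrightarrow> f i \<in> S) \<Longrightarrow> (\<Prod>i\<in>I. f i) \<in> S"
  by (induction I rule: infinite_finite_induct) (auto simp: subring_ofD)

lemma subring_of_power: "subring_of S \<Longrightarrow> x \<in> S \<Longrightarrow> x ^ n \<in> S"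
  by (induction n) (auto simp: subring_ofD)

lemma subring_of_of_nat: "subring_of S \<Longrightarrow> of_nat n \<in> S"
  by (induction n) (auto simp: subring_ofD)

lemma subring_of_of_int: "subring_of S \<Longrightarrow> of_int n \<in> S"
  by (cases n rule: int_cases2) (auto simp: subring_ofD subring_of_of_nat)

lemma subring_of_Rats: "subring_of (\<rat> :: 'a::field_char_0 set)"
  by (auto simp: subring_of_def)

lemma subring_of_subfield: "is_subfield K \<Longrightarrow> subring_of K"
  by (auto simp: subring_of_def is_subfield_def)

lemma coeff_poly_over: "P \<in> poly_over S \<Longrightarrow> coeff P i \<in> S"
  by (simp add: poly_over_def)

lemma poly_over_mono: "P \<in> poly_over S \<Longrightarrow> S \<subseteq> T \<Longrightarrow> P \<in> poly_over T"
  by (auto simp: poly_over_def)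

lemma subring_of_poly_over: "subring_of S \<Longrightarrow> subring_of (poly_over S)"
  unfolding subring_of_def[of "poly_over S"]
  by (auto simp: poly_over_def coeff_mult subring_ofD intro!: subring_of_sum)

lemma poly_over_monom: "subring_of S \<Longrightarrow> c \<in> S \<Longrightarrow> monom c n \<in> poly_over S"
  by (auto simp: poly_over_def subring_ofD)

lemma poly_over_pCons: "P \<in> poly_over S \<Longrightarrow> c \<in> S \<Longrightarrow> pCons c P \<in> poly_over S"
  by (auto simp: poly_over_def coeff_pCons split: nat.split)

lemma poly_over_linear: "subring_of S \<Longrightarrow> c \<in> S \<Longrightarrow> [:c, 1:] \<in> poly_over S"
  by (intro poly_over_pCons) (auto simp: poly_over_def subring_ofD)

lemma poly_over_smult: "subring_of S \<Longrightarrow> P \<in> poly_over S \<Longrightarrow> c \<in> S \<Longrightarrow> smult c P \<in> poly_over S"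
  by (auto simp: poly_over_def subring_ofD)

lemma poly_poly_over: "subring_of S \<Longrightarrow> P \<in> poly_over S \<Longrightarrow> x \<in> S \<Longrightarrow> poly P x \<in> S"
  unfolding poly_altdef by (intro subring_of_sum subring_ofD subring_of_power) (auto simp: poly_over_def)

text \<open>Long division by a monic polynomial never divides by a coefficient, so quotient and
  remainder stay over the subring although \<open>div\<close> and \<open>mod\<close> are taken over
  the field.\<close>

lemma poly_over_div_mod:
  fixes P A :: "'a::field poly"
  assumes S: "subring_of S" and P: "P \<in> poly_over S" "lead_coeff P = 1" and A: "A \<in> poly_over S"
  shows "A div P \<in> poly_over S \<and> A mod P \<in> poly_over S"
  using A
proof (induction "degree A" arbitrary: A rule: less_induct)
  case less
  note SP = subring_ofD[OF subring_of_poly_over[OF S]]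
  have P0: "P \<noteq> 0" using P(2) by auto
  show ?case
  proof (cases "degree A < degree P \<or> A = 0")
    case True
    thus ?thesis using less.prems SP(1) by (auto simp: div_poly_less mod_poly_less)
  next
    case False
    hence le: "degree P \<le> degree A" and A0: "A \<noteq> 0" by auto
    define M where "M = monom (lead_coeff A) (degree A - degree P)"
    define A' where "A' = A - M * P"
    have M: "M \<in> poly_over S" unfolding M_def
      by (intro poly_over_monom S coeff_poly_over less.prems)
    have A': "A' \<in> poly_over S" unfolding A'_def by (intro SP less.prems M P)
    have M0: "M \<noteq> 0" using A0 by (simp add: M_def)
    have deg: "degree (M * P) = degree A"
      using M0 P0 le A0 by (subst degree_mult_eq) (auto simp: M_def degree_monom_eq)
    have lc: "lead_coeff (M * P) = lead_coeff A"
      using A0 by (simp only: lead_coeff_mult P(2) M_def lead_coeff_monom mult_1_right)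
    have IH: "A' div P \<in> poly_over S \<and> A' mod P \<in> poly_over S"
    proof (cases "A' = 0")
      case True thus ?thesis using SP by simp
    next
      case False
      have "degree A' < degree A"
      proof -
        have "degree A' \<le> degree A" unfolding A'_def using deg degree_diff_le_max[of A "M * P"] by simp
        moreover have "coeff A' (degree A) = 0" using lc deg by (simp add: A'_def)
        ultimately show ?thesis using False by (metis leading_coeff_0_iff order_le_less)
      qed
      thus ?thesis using less.hyps A' by blast
    qed
    have "A = A' + P * M" by (simp add: A'_def mult.commute)
    hence "A div P = M + A' div P" "A mod P = A' mod P"
      using P0 by simp_all
    thus ?thesis using IH M SP by auto
  qed
qed

lemma monic_root_degree_pos:
  fixes P :: "'a::comm_ring_1 poly"
  assumes "lead_coeff P = 1" "poly P x = 0"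
  shows "degree P > 0"
proof (rule ccontr)
  assume "\<not> degree P > 0"
  then obtain c where "P = [:c:]" by (auto elim: degree_eq_zeroE)
  thus False using assms by auto
qed

lemma degree_mod_less_pos:
  fixes P A :: "'a::field poly"
  assumes "degree P > 0"
  shows "degree (A mod P) < degree P"
  using assms degree_mod_less[of P A] by (cases "P = 0") auto

lemma poly_mod_root: "poly P x = 0 \<Longrightarrow> poly (A mod P) x = poly (A::'a::field poly) x"
  by (metis div_mult_mod_eq add_0 mult_zero_right poly_add poly_mult)

lemma poly_sum_lessThan:
  fixes P :: "'a::comm_ring_1 poly"
  assumes "degree P < n"
  shows "poly P x = (\<Sum>i<n. coeff P i * x ^ i)"
proof -
  have "poly P x = (\<Sum>i\<le>degree P. coeff P i * x ^ i)" by (rule poly_altdef)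
  also have "\<dots> = (\<Sum>i<n. coeff P i * x ^ i)"
    by (rule sum.mono_neutral_left) (use assms in \<open>auto simp: coeff_eq_0\<close>)
  finally show ?thesis .
qed

text \<open>In the Lagrange basis \<open>L z\<close> of the polynomials of degree less than \<open>card Z\<close>, multiplication
  by \<open>q\<close> is diagonal with entries \<open>q z\<close>; in the monomial basis its trace is the left-hand side.\<close>

lemma trace_eq_sum_values:
  fixes Z :: "'a::field set"
  assumes fin: "finite Z" and d: "card Z = d"
    and deg: "\<And>b. b < d \<Longrightarrow> degree (r b) < d"
    and val: "\<And>b z. b < d \<Longrightarrow> z \<in> Z \<Longrightarrow> poly (r b) z = z ^ b * q z"
  shows "(\<Sum>b<d. coeff (r b) b) = (\<Sum>z\<in>Z. q z)"
proof -
  define L where "L z = smult (inverse (\<Prod>w\<in>Z-{z}. z - w)) (\<Prod>w\<in>Z-{z}. [:-w, 1:])" for z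
  have degL: "degree (L z) < d" if "z \<in> Z" for z
  proof -
    have "degree (\<Prod>w\<in>Z-{z}. [:-w, 1:]) = card (Z - {z})"
      by (subst degree_prod_eq_sum_degree) auto
    also have "\<dots> < d" using that fin d by (metis card_Diff1_less)
    finally show ?thesis by (auto simp: L_def)
  qed
  have L: "poly (L z) w = (if w = z then 1 else 0)" if "z \<in> Z" "w \<in> Z" for z w
  proof (cases "w = z")
    case True
    have "(\<Prod>w\<in>Z-{z}. z - w) \<noteq> 0" using fin by (subst prod_zero_iff) auto
    thus ?thesis using True by (simp add: L_def poly_prod)
  next
    case False
    hence "(\<Prod>v\<in>Z-{z}. w - v) = 0" using fin that by (subst prod_zero_iff) auto
    thus ?thesis using False by (simp add: L_def poly_prod)
  qed
  have r: "r b = (\<Sum>z\<in>Z. smult (z ^ b * q z) (L z))" if "b < d" for b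
  proof (rule poly_eqI_degree[of Z])
    fix x assume x: "x \<in> Z"
    have "(\<Sum>z\<in>Z. z ^ b * q z * poly (L z) x) = (\<Sum>z\<in>Z. if x = z then z ^ b * q z else 0)"
      by (rule sum.cong) (auto simp: L x)
    thus "poly (r b) x = poly (\<Sum>z\<in>Z. smult (z ^ b * q z) (L z)) x"
      using fin x by (simp add: val that poly_sum)
  next
    have "degree (\<Sum>z\<in>Z. smult (z ^ b * q z) (L z)) \<le> d - 1"
      by (rule degree_sum_le[OF fin])
         (use degL in \<open>fastforce intro: order.trans[OF degree_smult_le]\<close>)
    thus "degree (\<Sum>z\<in>Z. smult (z ^ b * q z) (L z)) < card Z" using that d by simp
  qed (use deg that d in auto)
  have "(\<Sum>b<d. coeff (r b) b) = (\<Sum>b<d. \<Sum>z\<in>Z. z ^ b * q z * coeff (L z) b)"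
    by (rule sum.cong) (auto simp: r coeff_sum)
  also have "\<dots> = (\<Sum>z\<in>Z. \<Sum>b<d. z ^ b * q z * coeff (L z) b)" by (rule sum.swap)
  also have "\<dots> = (\<Sum>z\<in>Z. q z)"
  proof (rule sum.cong)
    fix z assume z: "z \<in> Z"
    have "(\<Sum>b<d. z ^ b * q z * coeff (L z) b) = q z * (\<Sum>b<d. coeff (L z) b * z ^ b)"
      by (simp add: sum_distrib_left mult_ac)
    thus "(\<Sum>b<d. z ^ b * q z * coeff (L z) b) = q z"
      using L[OF z z] degL[OF z] by (simp flip: poly_sum_lessThan)
  qed simp
  finally show ?thesis .
qed

text \<open>The sum is the trace of multiplication by \<open>P\<close> modulo \<open>f\<close>. In
  the monomial basis its entries are coefficients of remainders, which lie in \<open>S\<close> even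
  when the roots do not.\<close>

lemma sum_roots_in_subring:
  fixes f P :: "'a::field poly"
  assumes S: "subring_of S" and f: "f \<in> poly_over S" "lead_coeff f = 1"
    and Z: "finite Z" "card Z = degree f" "\<And>z. z \<in> Z \<Longrightarrow> poly f z = 0" and P: "P \<in> poly_over S"
  shows "(\<Sum>z\<in>Z. poly P z) \<in> S"
proof (cases "degree f = 0")
  case False
  define r where "r b = (monom 1 b * P) mod f" for b
  have "(\<Sum>b<degree f. coeff (r b) b) = (\<Sum>z\<in>Z. poly P z)"
    by (rule trace_eq_sum_values)
       (use Z False in \<open>auto simp: r_def poly_mod_root poly_monom intro: degree_mod_less_pos\<close>)
  moreover have "r b \<in> poly_over S" for b
    unfolding r_def
    by (intro poly_over_div_mod[OF S f, THEN conjunct2] subring_ofD(4)[OF subring_of_poly_over[OF S]]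
      poly_over_monom[OF S] subring_ofD(2)[OF S] P)
  ultimately show ?thesis
    using subring_of_sum[OF S, of "{..<degree f}" "\<lambda>b. coeff (r b) b"] by (auto simp: coeff_poly_over)
qed (use Z S in \<open>auto simp: subring_ofD\<close>)

section \<open>Zeros of power sums\<close>

text \<open>For prime \<open>p\<close> this is the ring of integers localised at \<open>p\<close>.
  It takes the place of the p-adic integers.\<close>

definition zloc :: "nat \<Rightarrow> 'a::field_char_0 set" where
  "zloc p = {x. \<exists>a s::int. \<not> int p dvd s \<and> x = of_int a / of_int s}"

lemma zlocI: "\<not> int p dvd s \<Longrightarrow> x = of_int a / of_int s \<Longrightarrow> x \<in> zloc p"
  by (auto simp: zloc_def)

lemma zlocE:
  assumes "x \<in> zloc p"
  obtains a s :: int where "\<not> int p dvd s" "s \<noteq> 0" "x = of_int a / of_int s"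
  using assms by (auto simp: zloc_def)

lemma subring_of_zloc:
  assumes p: "prime p"
  shows "subring_of (zloc p :: 'a::field_char_0 set)"
proof -
  have p': "prime (int p)" using p by simp
  have one: "\<not> int p dvd 1" using p' not_prime_unit by blast
  have "x + y \<in> zloc p \<and> x * y \<in> zloc p" if xy: "x \<in> zloc p" "y \<in> zloc p" for x y :: 'a
  proof -
    from xy(1) obtain a s :: int where x: "\<not> int p dvd s" "s \<noteq> 0" "x = of_int a / of_int s" by (rule zlocE)
    from xy(2) obtain b t :: int where y: "\<not> int p dvd t" "t \<noteq> 0" "y = of_int b / of_int t" by (rule zlocE)
    have st: "\<not> int p dvd s * t" using x y p' prime_dvd_mult_iff by blast
    have "x + y = of_int (a * t + b * s) / of_int (s * t)" "x * y = of_int (a * b) / of_int (s * t)"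
      using x y by (auto simp: field_simps)
    thus ?thesis using st zlocI by blast
  qed
  moreover have "- x \<in> zloc p" if "x \<in> zloc p" for x :: 'a
    using that by (metis zlocE zlocI minus_divide_left of_int_minus)
  moreover have "(0::'a) \<in> zloc p" "(1::'a) \<in> zloc p"
    by (rule zlocI[OF one, of _ 0], simp) (rule zlocI[OF one, of _ 1], simp)
  ultimately show ?thesis unfolding subring_of_def by blast
qed

text \<open>The residue field is the integers modulo \<open>p\<close>: if \<open>u\<close> inverts
  \<open>s\<close> modulo \<open>p\<close>, then \<open>a / s\<close> is congruent to
  \<open>a * u\<close>.\<close>

lemma zloc_residue:
  assumes p: "prime p" and x: "x \<in> zloc p"
  shows "\<exists>r y. r \<in> {0..<int p} \<and> y \<in> zloc p \<and> x = of_int r + of_nat p * y"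
proof -
  from x obtain a s where x: "\<not> int p dvd s" "s \<noteq> 0" "x = of_int a / of_int s" by (rule zlocE)
  have "coprime s (int p)" using x(1) p by (metis coprime_commute prime_imp_coprime prime_nat_int_transfer)
  then obtain u v where uv: "u * s + v * int p = 1" by (metis bezout_int coprime_iff_gcd_eq_1)
  define r where "r = (a * u) mod int p"
  have r: "r \<in> {0..<int p}" using prime_gt_0_nat[OF p] by (simp add: r_def)
  define q where "q = (a * u) div int p"
  \<comment> \<open>Chosen so that \<open>a = r * s + p * c\<close>; dividing by \<open>s\<close>
    gives the claim.\<close>
  define c where "c = a * v + q * s"
  have au: "a * u = q * int p + r" unfolding q_def r_def div_mult_mod_eq ..
  have "a = (a * u) * s + a * v * int p" using arg_cong[OF uv, of "\<lambda>x. a * x"] by (simp add: algebra_simps)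
  hence c: "a = r * s + int p * c" unfolding au c_def by (simp add: algebra_simps)
  have "x = of_int r + of_nat p * (of_int c / of_int s)"
    using x by (simp add: c field_simps)
  thus ?thesis using r zlocI[OF x(1) refl] by blast
qed

text \<open>Separatedness of the p-adic topology. It replaces a limit: divisibility by every power
  of \<open>p\<close> is how a value is recognised as 0.\<close>

lemma zloc_infinitely_divisible:
  assumes p: "prime p" and x: "\<And>k. \<exists>y\<in>zloc p. x = of_nat p ^ k * y"
  shows "x = 0"
proof -
  have p': "prime (int p)" using p by simp
  have "x \<in> zloc p" using x[of 0] by auto
  then obtain a s where as: "\<not> int p dvd s" "s \<noteq> 0" "x = of_int a / of_int s" by (rule zlocE)
  have "int p ^ k dvd a" for k
  proof -
    obtain b t :: int where bt: "\<not> int p dvd t" "t \<noteq> 0" "x = of_nat p ^ k * (of_int b / of_int t)"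
      using x[of k] by (metis zlocE)
    have "of_int (a * t) = (of_int (int p ^ k * b * s) :: 'a)"
      using as bt by (simp add: field_simps)
    hence "a * t = int p ^ k * b * s" unfolding of_int_eq_iff .
    hence "int p ^ k dvd a * t" by simp
    moreover have "coprime (int p ^ k) t" using p' bt(1) by (simp add: prime_imp_coprime)
    ultimately show ?thesis by (simp add: coprime_dvd_mult_left_iff)
  qed
  hence "a = 0"
  proof -
    have "\<not> int p ^ nat \<bar>a\<bar> dvd a" if "a \<noteq> 0"
    proof
      assume "int p ^ nat \<bar>a\<bar> dvd a"
      hence "int p ^ nat \<bar>a\<bar> \<le> \<bar>a\<bar>" using that by (metis dvd_imp_le_int abs_of_nat of_nat_power)
      moreover have "nat \<bar>a\<bar> < p ^ nat \<bar>a\<bar>" using prime_gt_1_nat[OF p] by (simp add: power_gt_expt)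
      ultimately show False by (metis le_nat_iff abs_ge_zero nat_le_iff linorder_not_less of_nat_power)
    qed
    thus ?thesis using \<open>\<And>k. int p ^ k dvd a\<close> by blast
  qed
  thus ?thesis using as by simp
qed

lemma finite_Rats_common_denominator:
  fixes Y :: "'a::field_char_0 set"
  assumes "finite Y" "Y \<subseteq> \<rat>"
  shows "\<exists>M::nat. M > 0 \<and> (\<forall>x\<in>Y. of_nat M * x \<in> \<int>)"
  using assms
proof (induction Y rule: finite_induct)
  case (insert x Y)
  then obtain M :: nat where M: "M > 0" "\<forall>x\<in>Y. of_nat M * x \<in> \<int>" by auto
  from insert.prems have "x \<in> \<rat>" by auto
  then obtain a b :: int where ab: "b > 0" "x = of_int a / of_int b" by (metis Rats_cases')
  have "of_nat (M * nat b) * y \<in> \<int>" if "y \<in> insert x Y" for y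
  proof (cases "y = x")
    case True
    have "of_nat (M * nat b) * y = of_int (int M * a)" using ab True by simp
    thus ?thesis by (metis Ints_of_int)
  next
    case False
    hence "of_nat M * y \<in> \<int>" using that M by auto
    hence "of_int b * (of_nat M * y) \<in> \<int>" by simp
    thus ?thesis using ab by (simp add: mult_ac)
  qed
  thus ?case using M ab by (intro exI[of _ "M * nat b"]) auto
qed (auto intro: exI[of _ 1])

text \<open>Any prime beyond a common denominator works. It is taken odd for the sake of
  \<open>fact_prime_part\<close>.\<close>

lemma finite_Rats_subset_zloc:
  fixes Y :: "'a::field_char_0 set"
  assumes "finite Y" "Y \<subseteq> \<rat>"
  shows "\<exists>p. prime p \<and> p > 2 \<and> Y \<subseteq> zloc p"
proof -
  obtain M :: nat where M: "M > 0" "\<forall>x\<in>Y. of_nat M * x \<in> \<int>"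
    using finite_Rats_common_denominator[OF assms] by blast
  obtain p where p: "prime p" "p > M + 2" using bigger_prime by blast
  have pM: "\<not> int p dvd int M" using p M by (auto dest: dvd_imp_le)
  have "x \<in> zloc p" if "x \<in> Y" for x
  proof -
    obtain a where "of_nat M * x = of_int a" using M \<open>x \<in> Y\<close> by (metis Ints_cases)
    thus ?thesis using M by (intro zlocI[OF pM, of _ a]) (simp add: field_simps)
  qed
  thus ?thesis using p by (intro exI[of _ p]) auto
qed

section \<open>The power of a prime dividing a factorial\<close>

lemma fact_add_eq_prod: "fact (m + r) = (fact m * (\<Prod>j\<in>{1..r}. m + j) :: nat)"
  by (induction r) (auto simp: algebra_simps)

lemma prime_not_dvd_prod_shift:
  assumes "prime (p::nat)" "r < p" "p dvd m"
  shows "\<not> p dvd (\<Prod>j\<in>{1..r}. m + j)"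
proof
  assume "p dvd (\<Prod>j\<in>{1..r}. m + j)"
  then obtain j where "j \<in> {1..r}" "p dvd m + j" using assms(1) by (auto simp: prime_dvd_prod_iff)
  thus False using assms by (auto simp: dvd_add_right_iff dest: dvd_imp_le)
qed

text \<open>Among the \<open>p\<close> consecutive factors following \<open>p * q\<close> only the
  last, \<open>p * (q + 1)\<close>, is divisible by \<open>p\<close>.\<close>

lemma fact_mult_prime:
  assumes p: "prime (p::nat)"
  shows "\<exists>s. fact (p * q) = p ^ q * fact q * s \<and> \<not> p dvd s"
proof (induction q)
  case 0
  show ?case using p by (intro exI[of _ 1]) (auto dest: prime_gt_1_nat)
next
  case (Suc q)
  then obtain s where s: "fact (p * q) = p ^ q * fact q * s" "\<not> p dvd s" by blast
  define u where "u = (\<Prod>j\<in>{1..p-1}. p * q + j)"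
  have p1: "{1..p} = insert p {1..p-1}" using prime_gt_0_nat[OF p] by auto
  have u: "\<not> p dvd u" unfolding u_def
    by (rule prime_not_dvd_prod_shift) (use p prime_gt_0_nat[OF p] in auto)
  have pr: "(\<Prod>j\<in>{1..p}. p * q + j) = u * (p * q + p)"
    unfolding u_def p1 using prime_gt_0_nat[OF p] by (subst prod.insert) auto
  have "fact (p * Suc q) = (fact (p * q + p) :: nat)" by (simp add: add.commute)
  also have "\<dots> = p ^ Suc q * fact (Suc q) * (s * u)"
    unfolding fact_add_eq_prod s(1) pr by (simp add: algebra_simps)
  finally show ?case using s(2) u p prime_dvd_mult_iff by blast
qed

text \<open>A weak form of Legendre's bound v \<le> n / (p - 1). For \<open>p = 2\<close> the
  exponent can reach \<open>n - 1\<close>, which would spoil the growth needed below.\<close>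

lemma fact_prime_part:
  assumes p: "prime (p::nat)" "p > 2"
  shows "\<exists>v s. fact n = p ^ v * s \<and> \<not> p dvd s \<and> 2 * v \<le> n"
proof (induction n rule: less_induct)
  case (less n)
  show ?case
  proof (cases "n < p")
    case True
    thus ?thesis using p by (intro exI[of _ 0] exI[of _ "fact n"]) (auto simp: prime_dvd_fact_iff)
  next
    case False
    define q where "q = n div p"
    have n: "n = p * q + n mod p" by (simp add: q_def)
    have "q < n" using p False by (simp add: q_def)
    then obtain v s where vs: "fact q = p ^ v * s" "\<not> p dvd s" "2 * v \<le> q" using less by blast
    obtain t where t: "fact (p * q) = p ^ q * fact q * t" "\<not> p dvd t"
      using fact_mult_prime[OF p(1)] by blast
    define u where "u = (\<Prod>j\<in>{1..n mod p}. p * q + j)"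
    have u: "\<not> p dvd u" unfolding u_def
      by (rule prime_not_dvd_prod_shift) (use p in auto)
    have "fact n = fact (p * q) * u"
      by (subst n) (simp only: fact_add_eq_prod u_def)
    also have "\<dots> = p ^ (q + v) * (s * t * u)" by (simp add: t vs power_add)
    finally have "fact n = p ^ (q + v) * (s * t * u)" .
    moreover have "\<not> p dvd s * t * u" using vs t u p prime_dvd_mult_iff by blast
    moreover have "2 * (q + v) \<le> n"
    proof -
      have "2 * (q + v) \<le> 3 * q" using vs by simp
      also have "\<dots> \<le> p * q" using p by (intro mult_right_mono) auto
      also have "\<dots> \<le> n" by (simp add: q_def)
      finally show ?thesis .
    qed
    ultimately show ?thesis by blast
  qed
qed

text \<open>Division by \<open>fact i\<close> removes at most half of the \<open>i\<close> factors
  \<open>p\<close>.\<close>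

lemma prime_power_div_fact:
  assumes p: "prime p" "p > 2" and k: "2 * k \<le> i"
  shows "\<exists>y\<in>zloc p. of_nat p ^ i / fact i = of_nat p ^ k * (y :: 'a::field_char_0)"
proof -
  obtain v s where vs: "fact i = p ^ v * s" "\<not> p dvd s" "2 * v \<le> i"
    using fact_prime_part[OF p] by blast
  have s0: "s \<noteq> 0" using vs by (metis dvd_0_right)
  have "(fact i :: 'a) = of_nat (fact i)" by simp
  hence fi: "(fact i :: 'a) = of_nat p ^ v * of_nat s" unfolding vs(1) by simp
  have "i = k + (i - k - v) + v" using k vs by simp
  hence "(of_nat p :: 'a) ^ i = of_nat p ^ k * of_nat p ^ (i - k - v) * of_nat p ^ v"
    by (metis power_add)
  hence "of_nat p ^ i / fact i = of_nat p ^ k * (of_nat p ^ (i - k - v) / of_nat s :: 'a)"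
    using s0 p by (simp add: fi)
  moreover have "of_nat p ^ (i - k - v) / (of_nat s :: 'a) \<in> zloc p"
    using vs(2) by (intro zlocI[of p "int s" _ "int p ^ (i - k - v)"]) auto
  ultimately show ?thesis by blast
qed

text \<open>Hansel's lemma. If \<open>b\<close> vanishes on \<open>A\<close>, then division by \<open>\<Prod>a\<in>A. (X - a)\<close> removes the
  terms with \<open>i < card A\<close> from the Newton series of \<open>b\<close>; what remains is divisible by a high power
  of \<open>p\<close> because \<open>p ^ i / fact i\<close> is.\<close>

lemma binomial_series_eq_0:
  fixes d :: "nat \<Rightarrow> 'a::field_char_0"
  assumes p: "prime p" "p > 2" and d: "\<And>i. d i \<in> zloc p"
    and b: "\<And>n. b n = (\<Sum>i\<le>n. of_nat (n choose i) * of_nat p ^ i * d i)"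
    and inf: "infinite {n. b n = 0}"
  shows "b t = 0"
proof (rule zloc_infinitely_divisible[OF p(1)])
  fix k0
  note S = subring_of_zloc[OF p(1), where 'a='a]
  \<comment> \<open>The successor keeps \<open>2 * k - 1\<close> a proper degree bound; the surplus
    factor \<open>p\<close> is absorbed into \<open>Y\<close> at the end.\<close>
  define k where "k = Suc k0"
  \<comment> \<open>With 2 * k zeros only terms with i \<ge> 2 * k survive the division, and for
    these \<open>p ^ i / fact i\<close> is divisible by \<open>p ^ k\<close>.\<close>
  obtain A where A: "A \<subseteq> {n. b n = 0}" "finite A" "card A = 2 * k"
    using infinite_arbitrarily_large[OF inf] by blast
  \<comment> \<open>A common bound for \<open>t\<close> and all of \<open>A\<close>, so that one
    truncation \<open>P\<close> represents \<open>b\<close> at all these points.\<close>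
  define n where "n = t + \<Sum>A"
  have An: "a \<le> n" if "a \<in> A" for a using member_le_sum[OF that, of "\<lambda>x. x"] A(2) by (simp add: n_def)
  define D :: "'a poly" where "D = (\<Prod>a\<in>A. [:- of_nat a, 1:])"
  \<comment> \<open>Falling factorials: the value at \<open>x\<close> is \<open>fact i\<close> times
    a binomial coefficient. Their integer coefficients keep the quotients by \<open>D\<close> over
    \<open>zloc p\<close>, while the denominators \<open>fact i\<close> go into
    \<open>c\<close>.\<close>
  define ff :: "nat \<Rightarrow> 'a poly" where "ff i = (\<Prod>l\<in>{0..<i}. [:- of_nat l, 1:])" for i
  define c where "c i = of_nat p ^ i * d i / fact i" for i
  have lin: "[:- of_nat l, 1:] \<in> poly_over (zloc p :: 'a set)" for l
    by (intro poly_over_linear S subring_ofD(5)[OF S] subring_of_of_nat)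
  have degD: "degree D = 2 * k" using A by (simp add: D_def degree_prod_eq_sum_degree)
  have lcD: "lead_coeff D = 1" unfolding D_def lead_coeff_prod by simp
  have DS: "D \<in> poly_over (zloc p)" unfolding D_def
    by (intro subring_of_prod subring_of_poly_over S lin)
  have ffS: "ff i \<in> poly_over (zloc p)" for i unfolding ff_def
    by (intro subring_of_prod subring_of_poly_over S lin)
  have degff: "degree (ff i) = i" for i by (simp add: ff_def degree_prod_eq_sum_degree)
  have ffval: "poly (ff i) (of_nat x) = fact i * of_nat (x choose i)" for i x
    by (simp add: ff_def poly_prod binomial_gbinomial gbinomial_prod_rev)
  define P where "P = (\<Sum>i\<le>n. smult (c i) (ff i))"
  define R where "R = (\<Sum>i\<le>n. smult (c i) (ff i mod D))"
  define Q where "Q = (\<Sum>i\<in>{2*k..n}. smult (c i) (ff i div D))"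
  have bP: "b x = poly P (of_nat x)" if "x \<le> n" for x
  proof -
    have "b x = (\<Sum>i\<le>n. of_nat (x choose i) * of_nat p ^ i * d i)"
      unfolding b by (rule sum.mono_neutral_left) (use that in auto)
    also have "\<dots> = poly P (of_nat x)"
      by (simp add: P_def poly_sum ffval c_def mult_ac)
    finally show ?thesis .
  qed
  have Q: "Q = (\<Sum>i\<le>n. smult (c i) (ff i div D))" unfolding Q_def
    by (rule sum.mono_neutral_left) (auto simp: div_poly_less degff degD)
  have PQR: "P = D * Q + R"
  proof -
    have "D * Q + R = (\<Sum>i\<le>n. smult (c i) (D * (ff i div D) + ff i mod D))"
      unfolding Q R_def smult_add_right sum.distrib sum_distrib_left mult_smult_right ..
    thus ?thesis by (simp add: P_def)
  qed
  \<comment> \<open>\<open>R\<close> has degree below 2 * k but vanishes at the 2 * k points of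
    \<open>A\<close>, since both \<open>P\<close> and \<open>D\<close> do.\<close>
  have "R = 0"
  proof (rule poly_eqI_degree[of "of_nat ` A"])
    have cA: "card (of_nat ` A :: 'a set) = 2 * k" using A by (simp add: card_image inj_on_def)
    have "degree (ff i mod D) \<le> 2 * k - 1" for i
      using degree_mod_less_pos[of D "ff i"] degD by (simp add: k_def)
    hence "degree R \<le> 2 * k - 1" unfolding R_def
      by (intro degree_sum_le) (auto intro: order.trans[OF degree_smult_le])
    thus "degree R < card (of_nat ` A :: 'a set)" using cA by (simp add: k_def)
    show "degree 0 < card (of_nat ` A :: 'a set)" using cA by (simp add: k_def)
  next
    fix x :: 'a assume "x \<in> of_nat ` A"
    then obtain a where a: "a \<in> A" "x = of_nat a" by auto
    have "poly D x = 0" using a A by (auto simp: D_def poly_prod)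
    moreover have "poly P x = 0" using bP[of a] An[of a] a A by auto
    ultimately show "poly R x = poly 0 x" by (simp add: PQR)
  qed
  hence bt: "b t = poly D (of_nat t) * (\<Sum>i\<in>{2*k..n}. c i * poly (ff i div D) (of_nat t))"
    by (subst bP) (auto simp: n_def PQR Q_def poly_sum)
  have "\<forall>i\<in>{2*k..n}. \<exists>y\<in>zloc p. of_nat p ^ i / fact i = of_nat p ^ k * (y :: 'a)"
    using prime_power_div_fact[OF p] by auto
  then obtain y where y: "\<And>i. i \<in> {2*k..n} \<Longrightarrow> y i \<in> zloc p"
    "\<And>i. i \<in> {2*k..n} \<Longrightarrow> of_nat p ^ i / fact i = of_nat p ^ k * (y i :: 'a)" by metis
  define Y where "Y = of_nat p * (poly D (of_nat t) * (\<Sum>i\<in>{2*k..n}. y i * d i * poly (ff i div D) (of_nat t)))"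
  have "c i * w = of_nat p ^ k * (y i * d i * w)" if "i \<in> {2*k..n}" for i w
  proof -
    have "c i = (of_nat p ^ i / fact i) * d i" by (simp add: c_def)
    thus ?thesis using y(2)[OF that] by simp
  qed
  hence "b t = poly D (of_nat t) * (\<Sum>i\<in>{2*k..n}. of_nat p ^ k * (y i * d i * poly (ff i div D) (of_nat t)))"
    unfolding bt by (intro arg_cong[of _ _ "\<lambda>x. _ * x"] sum.cong refl)
  also have "\<dots> = of_nat p ^ k0 * Y"
    unfolding sum_distrib_left[symmetric] Y_def by (simp add: k_def mult_ac)
  finally have "b t = of_nat p ^ k0 * Y" .
  moreover have "poly (ff i div D) (of_nat t) \<in> zloc p" for i
    by (intro poly_poly_over S poly_over_div_mod[OF S DS lcD ffS, THEN conjunct1] subring_of_of_nat)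
  hence "Y \<in> zloc p" unfolding Y_def
    by (intro subring_ofD(4)[OF S] subring_of_of_nat[OF S] subring_of_sum[OF S] poly_poly_over[OF S DS] y d)
  ultimately show "\<exists>y\<in>zloc p. b t = of_nat p ^ k0 * y" by blast
qed

text \<open>Reduced modulo \<open>p\<close>, the remainders of X ^ n modulo \<open>f\<close> take
  finitely many values, so X ^ i and X ^ j agree for some i < j. As the constant coefficient is a
  unit, X is invertible modulo \<open>f\<close> and X ^ i can be cancelled. One \<open>N\<close> and
  one \<open>g\<close> serve all roots.\<close>

lemma roots_power_cong_1:
  fixes f :: "'a::field_char_0 poly"
  assumes p: "prime p" and f: "f \<in> poly_over (zloc p)" "lead_coeff f = 1" "degree f > 0"
    and unit: "coeff f 0 \<noteq> 0" "inverse (coeff f 0) \<in> zloc p"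
  shows "\<exists>N g. N > 0 \<and> g \<in> poly_over (zloc p) \<and>
           (\<forall>z. poly f z = 0 \<longrightarrow> z ^ N = 1 + of_nat p * poly g z)"
proof -
  note S = subring_of_zloc[OF p, where 'a='a]
  note SP = subring_ofD[OF subring_of_poly_over[OF S]]
  define R where "R n = monom 1 n mod f" for n
  have RS: "R n \<in> poly_over (zloc p)" for n unfolding R_def
    by (intro poly_over_div_mod[OF S f(1,2), THEN conjunct2] poly_over_monom S subring_ofD(2)[OF S])
  have degR: "degree (R n) < degree f" for n unfolding R_def by (rule degree_mod_less_pos[OF f(3)])
  have Rval: "z ^ n = poly (R n) z" if "poly f z = 0" for n z
    using that by (simp add: R_def poly_mod_root poly_monom)
  have "\<forall>n b. \<exists>r y. r \<in> {0..<int p} \<and> y \<in> zloc p \<and> coeff (R n) b = of_int r + of_nat p * y"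
    using zloc_residue[OF p] coeff_poly_over[OF RS] by blast
  then obtain r y where r: "\<And>n b. r n b \<in> {0..<int p}" and y: "\<And>n b. y n b \<in> zloc p"
    and ry: "\<And>n b. coeff (R n) b = of_int (r n b) + of_nat p * y n b" by metis
  define F where "F n = map (r n) [0..<degree f]" for n
  have "finite {xs. set xs \<subseteq> {0..<int p} \<and> length xs = degree f}"
    by (rule finite_lists_length_eq) simp
  moreover have "range F \<subseteq> {xs. set xs \<subseteq> {0..<int p} \<and> length xs = degree f}"
    using r by (auto simp: F_def)
  ultimately have "finite (range F)" by (rule rev_finite_subset)
  hence "\<not> inj F" using finite_imageD infinite_UNIV_nat by blast
  then obtain i j where "F i = F j" "i \<noteq> j" by (auto simp: inj_def)
  then obtain i j where F: "F i = F j" and ij: "i < j" by (metis linorder_neqE_nat)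
  have rij: "r i b = r j b" if "b < degree f" for b
    using arg_cong[OF F, of "\<lambda>xs. xs ! b"] that by (simp add: F_def)
  define G where "G = (\<Sum>b<degree f. monom (y j b - y i b) b)"
  \<comment> \<open>An inverse of X modulo \<open>f\<close>, read off from \<open>f\<close> =
    constant coefficient + X * \<open>poly_shift 1 f\<close>.\<close>
  define v where "v = smult (- inverse (coeff f 0)) (poly_shift 1 f)"
  have GS: "G \<in> poly_over (zloc p)" unfolding G_def
    by (intro subring_of_sum subring_of_poly_over S poly_over_monom subring_ofD(6)[OF S] y)
  have vS: "v \<in> poly_over (zloc p)" unfolding v_def
    using f(1) by (intro poly_over_smult S subring_ofD(5)[OF S] unit) (auto simp: poly_over_def coeff_poly_shift)
  have "z ^ (j - i) = 1 + of_nat p * poly (G * v ^ i) z" if z: "poly f z = 0" for z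
  proof -
    have "f = pCons (coeff f 0) (poly_shift 1 f)"
      by (rule poly_eqI) (auto simp: coeff_pCons coeff_poly_shift split: nat.split)
    from arg_cong[OF this, of "\<lambda>P. poly P z"]
    have "0 = coeff f 0 + z * poly (poly_shift 1 f) z" using z by simp
    hence zf: "z * poly (poly_shift 1 f) z = - coeff f 0" by (metis add_eq_0_iff)
    have "z * poly v z = - inverse (coeff f 0) * (z * poly (poly_shift 1 f) z)" by (simp add: v_def)
    hence zv: "z * poly v z = 1" unfolding zf using unit(1) by simp
    have zj: "z ^ j = z ^ i * z ^ (j - i)" using ij by (simp flip: power_add)
    have "z ^ j - z ^ i = (\<Sum>b<degree f. (coeff (R j) b - coeff (R i) b) * z ^ b)"
      by (simp add: Rval[OF z, of i] Rval[OF z, of j] poly_sum_lessThan[OF degR] sum_subtractf left_diff_distrib)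
    also have "\<dots> = of_nat p * poly G z"
      by (simp add: ry rij G_def poly_sum poly_monom sum_distrib_left algebra_simps)
    finally have "z ^ i * (z ^ (j - i) - 1) = of_nat p * poly G z"
      by (simp add: zj right_diff_distrib)
    hence "(z * poly v z) ^ i * (z ^ (j - i) - 1) = of_nat p * poly (G * v ^ i) z"
      by (simp add: power_mult_distrib mult_ac)
    thus ?thesis by (simp add: zv algebra_simps)
  qed
  moreover have "G * v ^ i \<in> poly_over (zloc p)"
    by (intro SP GS subring_of_power subring_of_poly_over S vS)
  ultimately show ?thesis using ij by (intro exI[of _ "j - i"] exI[of _ "G * v ^ i"]) auto
qed

text \<open>The Skolem--Mahler--Lech theorem for power sums, after Hansel: for a suitable prime \<open>p\<close>, the
  restriction to each residue class modulo \<open>N\<close> is a binomial series in powers of \<open>p\<close>.\<close>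

theorem power_sums_zero_progression:
  fixes f :: "'a::field_char_0 poly"
  assumes f: "f \<in> poly_over \<rat>" "lead_coeff f = 1" "coeff f 0 \<noteq> 0"
    and Z: "finite Z" "card Z = degree f" "\<And>z. z \<in> Z \<Longrightarrow> poly f z = 0"
    and inf: "infinite {n. (\<Sum>z\<in>Z. z ^ n) = 0}"
  shows "\<exists>a N. N > 0 \<and> (\<forall>k. (\<Sum>z\<in>Z. z ^ (a + N * k)) = 0)"
proof (cases "degree f = 0")
  case True
  hence "Z = {}" using Z by simp
  thus ?thesis by (intro exI[of _ 1]) auto
next
  case False
  \<comment> \<open>The inverse of the constant coefficient is included because
    \<open>roots_power_cong_1\<close> needs it in \<open>zloc p\<close>.\<close>
  have "finite (insert (inverse (coeff f 0)) (coeff f ` {..degree f}))" by simp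
  moreover have "insert (inverse (coeff f 0)) (coeff f ` {..degree f}) \<subseteq> \<rat>"
    using f(1) by (auto simp: poly_over_def)
  ultimately obtain p where p: "prime p" "p > 2"
    and Y: "insert (inverse (coeff f 0)) (coeff f ` {..degree f}) \<subseteq> zloc p"
    using finite_Rats_subset_zloc by blast
  note S = subring_of_zloc[OF p(1), where 'a='a]
  have "coeff f i \<in> zloc p" for i
    using Y subring_ofD(1)[OF S] by (cases "i \<le> degree f") (auto simp: coeff_eq_0)
  hence fS: "f \<in> poly_over (zloc p)" by (simp add: poly_over_def)
  obtain N g where N: "N > 0" and g: "g \<in> poly_over (zloc p)"
    and Ng: "\<And>z. poly f z = 0 \<Longrightarrow> z ^ N = 1 + of_nat p * poly g z"
    using roots_power_cong_1[OF p(1) fS f(2) _ f(3)] Y False by auto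
  have "\<exists>a<N. infinite {k. (\<Sum>z\<in>Z. z ^ (a + N * k)) = 0}"
  proof (rule ccontr)
    assume "\<not> ?thesis"
    hence "finite (\<Union>a<N. (\<lambda>k. a + N * k) ` {k. (\<Sum>z\<in>Z. z ^ (a + N * k)) = 0})" by auto
    moreover have "{n. (\<Sum>z\<in>Z. z ^ n) = 0} \<subseteq> (\<Union>a<N. (\<lambda>k. a + N * k) ` {k. (\<Sum>z\<in>Z. z ^ (a + N * k)) = 0})"
    proof
      fix n assume "n \<in> {n. (\<Sum>z\<in>Z. z ^ n) = 0}"
      thus "n \<in> (\<Union>a<N. (\<lambda>k. a + N * k) ` {k. (\<Sum>z\<in>Z. z ^ (a + N * k)) = 0})"
        using N by (intro UN_I[of "n mod N"] image_eqI[of _ _ "n div N"]) auto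
    qed
    ultimately show False using inf finite_subset by blast
  qed
  then obtain a where a: "infinite {k. (\<Sum>z\<in>Z. z ^ (a + N * k)) = 0}" by blast
  have "(\<Sum>z\<in>Z. z ^ (a + N * k)) = 0" for k
  proof (rule binomial_series_eq_0[where b = "\<lambda>k. \<Sum>z\<in>Z. z ^ (a + N * k)", OF p _ _ a])
    fix i
    \<comment> \<open>The coefficients of the binomial series are sums over all roots of a single
      polynomial over \<open>zloc p\<close>; this is what makes them rational and integral at
      \<open>p\<close>.\<close>
    have "monom 1 a * g ^ i \<in> poly_over (zloc p)"
      by (intro subring_ofD(4)[OF subring_of_poly_over[OF S]] poly_over_monom S subring_ofD(2)[OF S]
            subring_of_power subring_of_poly_over g)
    from sum_roots_in_subring[OF S fS f(2) Z this]
    show "(\<Sum>z\<in>Z. z ^ a * poly g z ^ i) \<in> zloc p" by (simp add: poly_monom)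
  next
    fix k
    have "z ^ (a + N * k) = (\<Sum>i\<le>k. of_nat (k choose i) * of_nat p ^ i * (z ^ a * poly g z ^ i))"
      if "z \<in> Z" for z
    proof -
      have "z ^ (a + N * k) = z ^ a * (of_nat p * poly g z + 1) ^ k"
        using Ng[OF Z(3)[OF that]] by (simp add: power_add power_mult add.commute)
      also have "\<dots> = (\<Sum>i\<le>k. of_nat (k choose i) * of_nat p ^ i * (z ^ a * poly g z ^ i))"
        unfolding binomial_ring by (simp add: sum_distrib_left power_mult_distrib mult_ac)
      finally show ?thesis .
    qed
    hence "(\<Sum>z\<in>Z. z ^ (a + N * k)) =
        (\<Sum>z\<in>Z. \<Sum>i\<le>k. of_nat (k choose i) * of_nat p ^ i * (z ^ a * poly g z ^ i))" by simp
    also have "\<dots> = (\<Sum>i\<le>k. of_nat (k choose i) * of_nat p ^ i * (\<Sum>z\<in>Z. z ^ a * poly g z ^ i))"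
      by (subst sum.swap) (simp add: sum_distrib_left)
    finally show "(\<Sum>z\<in>Z. z ^ (a + N * k)) =
        (\<Sum>i\<le>k. of_nat (k choose i) * of_nat p ^ i * (\<Sum>z\<in>Z. z ^ a * poly g z ^ i))" .
  qed
  thus ?thesis using N by blast
qed

section \<open>Finite extensions of the rationals\<close>

lemma map_poly_of_int_mult:
  "map_poly of_int (p * q) = map_poly of_int p * (map_poly of_int q :: 'a::field_char_0 poly)"
  by (rule poly_eqI) (simp add: coeff_mult coeff_map_poly)

text \<open>More powers than the dimension allows force a relation. Independence is a property of
  sets, so coinciding powers are treated apart; they give X ^ j - X ^ i.\<close>

lemma rat_algebraic_if_powers_in_span:
  fixes x :: "'a::field_char_0"
  assumes B: "finite B" and x: "\<And>i. x ^ i \<in> rat_vs.span B"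
  shows "\<exists>P\<in>poly_over \<rat>. P \<noteq> 0 \<and> degree P \<le> card B \<and> poly P x = 0"
proof (cases "inj_on (\<lambda>i. x ^ i) {..card B}")
  case False
  then obtain i j where "i \<in> {..card B}" "j \<in> {..card B}" "x ^ i = x ^ j" "i \<noteq> j"
    unfolding inj_on_def by blast
  then obtain i j where ij: "i < j" "j \<le> card B" "x ^ i = x ^ j"
    by (metis atMost_iff linorder_neqE_nat)
  define P :: "'a poly" where "P = monom 1 j - monom 1 i"
  have "coeff P j = 1" using ij by (simp add: P_def)
  hence "P \<noteq> 0" by auto
  moreover have "degree P \<le> card B" unfolding P_def
    using ij by (intro degree_diff_le) (auto simp: degree_monom_eq)
  moreover have "P \<in> poly_over \<rat>" unfolding P_def
    by (intro subring_ofD(6) subring_of_poly_over poly_over_monom subring_of_Rats Rats_1)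
  ultimately show ?thesis using ij by (intro bexI[of _ P]) (auto simp: P_def poly_monom)
next
  case True
  define T where "T = (\<lambda>i. x ^ i) ` {..card B}"
  have T: "finite T" "card T = Suc (card B)" using True by (auto simp: T_def card_image)
  have "\<not> rat_vs.independent T"
  proof
    assume "rat_vs.independent T"
    from rat_vs.independent_span_bound[OF B this] x have "card T \<le> card B" by (auto simp: T_def)
    thus False using T by simp
  qed
  then obtain u v where uv: "v \<in> T" "u v \<noteq> 0" "(\<Sum>v\<in>T. of_rat (u v) * v) = 0"
    unfolding rat_vs.dependent_finite[OF T(1)] by blast
  define P where "P = (\<Sum>i\<le>card B. monom (of_rat (u (x ^ i)) :: 'a) i)"
  have coeffP: "coeff P i = (if i \<le> card B then of_rat (u (x ^ i)) else 0)" for i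
    by (simp add: P_def coeff_sum)
  from uv obtain i where "i \<le> card B" "v = x ^ i" by (auto simp: T_def)
  hence "coeff P i \<noteq> 0" using uv by (simp add: coeffP)
  hence "P \<noteq> 0" by auto
  moreover have "degree P \<le> card B" by (rule degree_le) (simp add: coeffP)
  moreover have "P \<in> poly_over \<rat>" by (simp add: poly_over_def coeffP)
  moreover have "poly P x = 0"
    using uv(3) True by (simp add: P_def T_def poly_sum poly_monom sum.reindex)
  ultimately show ?thesis by blast
qed

text \<open>Factors X are stripped from \<open>P\<close> until its constant coefficient
  \<open>a\<close> is nonzero; then x * P(x) = - a yields the inverse.\<close>

lemma inverse_eq_poly:
  fixes x :: "'a::field_char_0"
  assumes "P \<in> poly_over \<rat>" "P \<noteq> 0" "poly P x = 0" "x \<noteq> 0"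
  shows "\<exists>Q\<in>poly_over \<rat>. inverse x = poly Q x"
  using assms
proof (induction P)
  case (pCons a P)
  have P: "P \<in> poly_over \<rat>" and a: "a \<in> \<rat>"
    using coeff_poly_over[OF pCons.prems(1), of "Suc _"] coeff_poly_over[OF pCons.prems(1), of 0]
    by (auto simp: poly_over_def)
  show ?case
  proof (cases "a = 0")
    case True
    thus ?thesis using pCons P by auto
  next
    case False
    have "x * poly P x = - a" using pCons.prems by (simp add: eq_neg_iff_add_eq_0 add.commute)
    hence "- inverse a * (x * poly P x) = 1" using False by simp
    hence "x * poly (smult (- inverse a) P) x = 1" by (simp add: mult.left_commute)
    hence "inverse x = poly (smult (- inverse a) P) x" by (rule inverse_unique)
    moreover have "smult (- inverse a) P \<in> poly_over \<rat>"
      using a by (intro poly_over_smult subring_of_Rats P) auto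
    ultimately show ?thesis by blast
  qed
qed simp

text \<open>A finite-dimensional domain over \<rat> is a field, since each nonzero element has an
  inverse polynomial in itself.\<close>

lemma is_subfield_if_finite_span:
  fixes R :: "'a::field_char_0 set"
  assumes R: "subring_of R" "\<rat> \<subseteq> R" and B: "finite B" "R \<subseteq> rat_vs.span B"
  shows "is_subfield R"
proof -
  have "inverse x \<in> R" if x: "x \<in> R" for x
  proof (cases "x = 0")
    case False
    have "x ^ i \<in> rat_vs.span B" for i using subring_of_power[OF R(1) x] B by blast
    from rat_algebraic_if_powers_in_span[OF B(1) this] obtain P
      where "P \<in> poly_over \<rat>" "P \<noteq> 0" "poly P x = 0" by blast
    from inverse_eq_poly[OF this False] obtain Q where Q: "Q \<in> poly_over \<rat>" "inverse x = poly Q x" by blast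
    thus ?thesis using poly_poly_over[OF R(1) poly_over_mono[OF Q(1) R(2)] x] by simp
  qed (use subring_ofD(1)[OF R(1)] in auto)
  thus ?thesis using R(1) by (auto simp: is_subfield_def subring_of_def)
qed

lemma subring_of_poly_values:
  fixes z :: "'a::comm_ring_1"
  assumes R: "subring_of R"
  shows "subring_of ((\<lambda>P. poly P z) ` poly_over R)"
proof -
  note RP = subring_ofD[OF subring_of_poly_over[OF R]]
  let ?V = "(\<lambda>P. poly P z) ` poly_over R"
  have "x + y \<in> ?V \<and> x * y \<in> ?V" if xy: "x \<in> ?V" "y \<in> ?V" for x y
  proof -
    from xy obtain P Q where "P \<in> poly_over R" "Q \<in> poly_over R" "x = poly P z" "y = poly Q z" by auto
    thus ?thesis using RP(3)[of P Q] RP(4)[of P Q]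
      by (auto intro: image_eqI[of _ _ "P + Q"] image_eqI[of _ _ "P * Q"])
  qed
  moreover have "- x \<in> ?V" if x: "x \<in> ?V" for x
  proof -
    from x obtain P where "P \<in> poly_over R" "x = poly P z" by auto
    thus ?thesis using RP(5)[of P] by (auto intro: image_eqI[of _ _ "- P"])
  qed
  moreover have "0 \<in> ?V" "1 \<in> ?V"
    using RP(1,2) by (auto intro: image_eqI[of _ _ 0] image_eqI[of _ _ 1])
  ultimately show ?thesis unfolding subring_of_def by blast
qed

lemma poly_values_superset:
  assumes R: "subring_of R"
  shows "insert z R \<subseteq> (\<lambda>P. poly P z) ` poly_over R"
proof -
  have "poly [:0, 1:] z \<in> (\<lambda>P. poly P z) ` poly_over R"
    by (intro imageI poly_over_linear R subring_ofD(1)[OF R])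
  moreover have "poly [:c:] z \<in> (\<lambda>P. poly P z) ` poly_over R" if "c \<in> R" for c
    using that R by (intro imageI poly_over_pCons) (auto simp: poly_over_def subring_ofD)
  ultimately show ?thesis by auto
qed

text \<open>Spanning half of the tower law: reduction modulo \<open>f\<close> leaves powers of
  \<open>z\<close> below \<open>degree f\<close>, with coefficients that expand in
  \<open>B\<close>.\<close>

lemma poly_values_subset_span:
  fixes z :: "'a::field_char_0"
  assumes R: "subring_of R" "\<rat> \<subseteq> R" "R \<subseteq> rat_vs.span B"
    and f: "f \<in> poly_over \<rat>" "lead_coeff f = 1" "poly f z = 0"
  shows "(\<lambda>P. poly P z) ` poly_over R \<subseteq> rat_vs.span ((\<lambda>(b, i). b * z ^ i) ` (B \<times> {..<degree f}))"
proof safe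
  fix P assume P: "P \<in> poly_over R"
  let ?B = "(\<lambda>(b, i). b * z ^ i) ` (B \<times> {..<degree f})"
  have d: "degree f > 0" by (rule monic_root_degree_pos[OF f(2,3)])
  have sub: "c * z ^ i \<in> rat_vs.span ?B" if "c \<in> R" "i < degree f" for c i
  proof -
    have "c \<in> rat_vs.span B" using that R by auto
    thus ?thesis
    proof (induction rule: rat_vs.span_induct_alt)
      case base
      show ?case using rat_vs.span_zero by simp
    next
      case (step q x y)
      have "x * z ^ i \<in> rat_vs.span ?B"
        using step that by (intro rat_vs.span_base) (auto intro!: image_eqI[of _ _ "(x, i)"])
      from rat_vs.span_add[OF rat_vs.span_scale[OF this, of q] step.IH]
      show ?case by (simp add: algebra_simps)
    qed
  qed
  have "P mod f \<in> poly_over R"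
    using poly_over_div_mod[OF R(1) poly_over_mono[OF f(1) R(2)] f(2) P] by blast
  moreover have "poly P z = (\<Sum>i<degree f. coeff (P mod f) i * z ^ i)"
    using poly_mod_root[OF f(3), of P] poly_sum_lessThan[OF degree_mod_less_pos[OF d], of P] by simp
  ultimately show "poly P z \<in> rat_vs.span ?B"
    by (auto intro!: rat_vs.span_sum sub simp: coeff_poly_over)
qed

lemma Rats_subset_span_1: "\<rat> \<subseteq> rat_vs.span {1::'a::field_char_0}"
proof
  fix x :: 'a assume "x \<in> \<rat>"
  then obtain q where "x = of_rat q" by (auto elim: Rats_cases)
  thus "x \<in> rat_vs.span {1}" using rat_vs.span_scale[OF rat_vs.span_base[of 1 "{1}"], of q] by simp
qed

section \<open>Fields generated by algebraic numbers\<close>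

lemma is_subfield_rat_adjoin: "is_subfield (rat_adjoin S)"
  unfolding rat_adjoin_def is_subfield_def by auto

lemma rat_adjoin_superset: "S \<subseteq> rat_adjoin S"
  unfolding rat_adjoin_def by auto

lemma rat_adjoin_minimal: "is_subfield K \<Longrightarrow> S \<subseteq> K \<Longrightarrow> rat_adjoin S \<subseteq> K"
  unfolding rat_adjoin_def by auto

lemma Rats_subset_subfield: 
  assumes "is_subfield (K :: 'a::field_char_0 set)"
  shows "\<rat> \<subseteq> K"
proof
  fix x :: 'a assume "x \<in> \<rat>"
  then obtain a b where "x = of_int a / of_int b" by (metis Rats_cases')
  thus "x \<in> K" using assms subring_of_of_int[OF subring_of_subfield[OF assms]]
    unfolding divide_inverse is_subfield_def by blast
qed

lemma rat_adjoin_finite_span: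
  fixes Z :: "'a::field_char_0 set"
  assumes "finite Z" "\<And>z. z \<in> Z \<Longrightarrow> \<exists>f\<in>poly_over \<rat>. lead_coeff f = 1 \<and> poly f z = 0"
  shows "\<exists>B. finite B \<and> rat_adjoin Z \<subseteq> rat_vs.span B"
proof -
  \<comment> \<open>The induction adjoins one number at a time to a ring; being a field is recovered
    once, at the end, from finite dimension.\<close>
  have "\<exists>R B. subring_of R \<and> \<rat> \<subseteq> R \<and> Z \<subseteq> R \<and> finite B \<and> R \<subseteq> rat_vs.span B"
    using assms
  proof (induction Z rule: finite_induct)
    case empty
    show ?case using subring_of_Rats Rats_subset_span_1 by blast
  next
    case (insert z Z)
    then obtain R B where RB: "subring_of R" "\<rat> \<subseteq> R" "Z \<subseteq> R" "finite B" "R \<subseteq> rat_vs.span B" by auto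
    have "\<exists>f\<in>poly_over \<rat>. lead_coeff f = 1 \<and> poly f z = 0" by (rule insert.prems) simp
    then obtain f where f: "f \<in> poly_over \<rat>" "lead_coeff f = 1" "poly f z = 0" by blast
    let ?R = "(\<lambda>P. poly P z) ` poly_over R"
    have "finite ((\<lambda>(b, i). b * z ^ i) ` (B \<times> {..<degree f}))" using RB by simp
    moreover have "insert z R \<subseteq> ?R" by (rule poly_values_superset[OF RB(1)])
    ultimately show ?case
      using subring_of_poly_values[OF RB(1), of z] poly_values_subset_span[OF RB(1,2,5) f] RB
      by (intro exI[of _ ?R] exI[of _ "(\<lambda>(b, i). b * z ^ i) ` (B \<times> {..<degree f})"]) auto
  qed
  then obtain R B where RB: "subring_of R" "\<rat> \<subseteq> R" "Z \<subseteq> R" "finite B" "R \<subseteq> rat_vs.span B" by auto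
  hence "rat_adjoin Z \<subseteq> R" by (intro rat_adjoin_minimal is_subfield_if_finite_span)
  thus ?thesis using RB by blast
qed

section \<open>Roots of unity in a finite extension\<close>

text \<open>Preparation for Gauss's lemma: clear denominators by \<open>M\<close>, then divide by
  the content.\<close>

lemma monic_rat_poly_primitive_multiple:
  fixes g :: "'a::field_char_0 poly"
  assumes g: "g \<in> poly_over \<rat>" "lead_coeff g = 1"
  shows "\<exists>(c::int) G. c > 0 \<and> smult (of_int c) g = map_poly of_int G \<and> content G = 1"
proof -
  have "finite (coeff g ` {..degree g})" "coeff g ` {..degree g} \<subseteq> \<rat>"
    using g by (auto simp: poly_over_def)
  from finite_Rats_common_denominator[OF this] obtain M :: nat
    where M: "M > 0" "\<And>i. i \<le> degree g \<Longrightarrow> of_nat M * coeff g i \<in> \<int>" by auto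
  have "coeff (smult (of_nat M) g) i \<in> \<int>" for i
    using M(2)[of i] by (cases "i \<le> degree g") (auto simp: coeff_eq_0)
  then obtain G where G: "smult (of_nat M) g = map_poly of_int G" by (rule intpolyE)
  have Mk: "int M = coeff G (degree g)"
    using arg_cong[OF G, of "\<lambda>P. coeff P (degree g)"] g(2)
    by (simp add: coeff_map_poly) (metis of_int_eq_iff of_int_of_nat_eq)
  define k where "k = content G"
  \<comment> \<open>As \<open>g\<close> is monic, \<open>M\<close> is the leading coefficient of
    \<open>G\<close>, so the content divides it and the final scalar \<open>c\<close> is an
    integer.\<close>
  have "k dvd int M" unfolding Mk k_def by simp
  then obtain c where c: "int M = k * c" by auto
  have "k \<ge> 0" unfolding k_def by (metis abs_ge_zero normalize_content normalize_int_def)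
  hence "k > 0" "c > 0" using c M(1) by (smt (verit) mult_le_0_iff of_nat_0_less_iff)+
  have k: "(of_int k :: 'a) \<noteq> 0" using \<open>k > 0\<close> by simp
  have "map_poly of_int G = smult (of_int k) (map_poly of_int (primitive_part G) :: 'a poly)"
    unfolding k_def by (subst (1) content_times_primitive_part[of G, symmetric])
      (simp add: poly_eq_iff coeff_map_poly del: content_times_primitive_part)
  moreover have "smult (of_nat M) g = smult (of_int k) (smult (of_int c) g)"
    using arg_cong[OF c, of "of_int :: int \<Rightarrow> 'a"] by simp
  ultimately have "smult (of_int k) (smult (of_int c) g) = smult (of_int k) (map_poly of_int (primitive_part G))"
    using G by simp
  hence "smult (of_int c) g = map_poly of_int (primitive_part G)"
    using k by (metis smult_cancel)
  moreover have "content (primitive_part G) = 1" using \<open>k > 0\<close> unfolding k_def by (intro content_primitive_part) auto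
  ultimately show ?thesis using \<open>c > 0\<close> by blast
qed

text \<open>Gauss's lemma: the primitive multiples of \<open>g\<close> and \<open>h\<close> have a
  product of content 1, while that product is \<open>c * c'\<close> times an integer polynomial.
  Hence \<open>c = 1\<close>.\<close>

lemma monic_factor_integral:
  fixes g h :: "'a::field_char_0 poly"
  assumes g: "g \<in> poly_over \<rat>" "lead_coeff g = 1" and h: "h \<in> poly_over \<rat>" "lead_coeff h = 1"
    and gh: "g * h = map_poly of_int F"
  shows "\<exists>G. g = map_poly of_int G"
proof -
  from monic_rat_poly_primitive_multiple[OF g] obtain c :: int and G
    where G: "c > 0" "smult (of_int c) g = map_poly of_int G" "content G = 1" by blast
  from monic_rat_poly_primitive_multiple[OF h] obtain c' :: int and H
    where H: "c' > 0" "smult (of_int c') h = map_poly of_int H" "content H = 1" by blast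
  have "map_poly of_int (G * H) = smult (of_int c) g * smult (of_int c') h"
    using G H by (simp add: map_poly_of_int_mult)
  also have "\<dots> = (map_poly of_int (smult (c * c') F) :: 'a poly)"
    by (simp add: gh poly_eq_iff coeff_map_poly mult_ac)
  finally have "G * H = smult (c * c') F"
    unfolding poly_eq_iff by (simp add: coeff_map_poly flip: of_int_mult)
  hence "content (G * H) = c * c' * content F" using G H by (simp add: abs_mult normalize_int_def)
  hence "1 = c * (c' * content F)" using G H by (simp add: content_mult)
  hence "c dvd 1" by (rule dvdI)
  hence "c = 1" using G by simp
  thus ?thesis using G by auto
qed

text \<open>Each linear factor adds a shifted copy to a multiple by a scalar of norm at most 1,
  hence at most doubles the bound.\<close>

lemma coeff_prod_linear_bound:
  fixes A :: "complex multiset"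
  assumes "\<And>a. a \<in># A \<Longrightarrow> norm a \<le> 1"
  shows "norm (coeff (\<Prod>a\<in>#A. [:- a, 1:]) i) \<le> 2 ^ size A"
  using assms
proof (induction A arbitrary: i)
  case empty
  show ?case by (simp add: coeff_1)
next
  case (add a A)
  let ?Q = "\<Prod>a\<in>#A. [:- a, 1:]"
  have IH: "norm (coeff ?Q j) \<le> 2 ^ size A" for j using add by auto
  have "norm (a * coeff ?Q i) \<le> 2 ^ size A"
    unfolding norm_mult using mult_mono[of "norm a" 1 "norm (coeff ?Q i)" "2 ^ size A"] IH add.prems by simp
  moreover have "norm (case i of 0 \<Rightarrow> 0 | Suc j \<Rightarrow> coeff ?Q j) \<le> 2 ^ size A"
    using IH by (auto split: nat.split)
  ultimately have "norm (- (a * coeff ?Q i)) + norm (case i of 0 \<Rightarrow> 0 | Suc j \<Rightarrow> coeff ?Q j) \<le> 2 * 2 ^ size A"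
    by simp
  hence "norm (- (a * coeff ?Q i) + (case i of 0 \<Rightarrow> 0 | Suc j \<Rightarrow> coeff ?Q j)) \<le> 2 * 2 ^ size A"
    using norm_triangle_ineq order.trans by blast
  thus ?case by (simp add: mult_pCons_left coeff_pCons)
qed

lemma finite_bounded_int_polys: "finite {p :: int poly. degree p \<le> D \<and> (\<forall>i. \<bar>coeff p i\<bar> \<le> C)}"
proof -
  have "finite (Poly ` {xs. set xs \<subseteq> {-C..C} \<and> length xs \<le> Suc D})"
    by (intro finite_imageI finite_lists_length_le) simp
  moreover have "{p :: int poly. degree p \<le> D \<and> (\<forall>i. \<bar>coeff p i\<bar> \<le> C)} \<subseteq>
      Poly ` {xs. set xs \<subseteq> {-C..C} \<and> length xs \<le> Suc D}"
  proof safe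
    fix p :: "int poly" assume p: "degree p \<le> D" "\<forall>i. \<bar>coeff p i\<bar> \<le> C"
    have "set (coeffs p) \<subseteq> {-C..C}"
    proof
      fix x assume "x \<in> set (coeffs p)"
      then obtain i where "x = coeff p i" by (auto simp: coeffs_def split: if_splits)
      thus "x \<in> {-C..C}" using p(2)[rule_format, of i] by auto
    qed
    moreover have "length (coeffs p) \<le> Suc D" using p by (cases "p = 0") (auto simp: length_coeffs_degree)
    ultimately show "p \<in> Poly ` {xs. set xs \<subseteq> {-C..C} \<and> length xs \<le> Suc D}"
      by (intro image_eqI[of _ _ "coeffs p"]) auto
  qed
  ultimately show ?thesis by (rule rev_finite_subset)
qed


section \<open>Minimal polynomials over a subfield, and finiteness of the torsion\<close>

lemma is_subfield_Rats: "is_subfield (\<rat> :: 'a::field_char_0 set)"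
  by (auto simp: is_subfield_def)

lemma monic_minimal_poly:
  fixes x :: "'a::field_char_0"
  assumes K: "is_subfield K" and P: "P \<in> poly_over K" "P \<noteq> 0" "poly P x = 0"
  obtains g where "g \<in> poly_over K" "lead_coeff g = 1" "poly g x = 0"
    "\<And>Q. Q \<in> poly_over K \<Longrightarrow> poly Q x = 0 \<Longrightarrow> Q \<noteq> 0 \<Longrightarrow> degree g \<le> degree Q"
    "\<And>Q. Q \<in> poly_over K \<Longrightarrow> poly Q x = 0 \<Longrightarrow> \<exists>h\<in>poly_over K. Q = g * h"
proof -
  note S = subring_of_subfield[OF K]
  define Q where "Q = arg_min degree (\<lambda>Q. Q \<in> poly_over K \<and> Q \<noteq> 0 \<and> poly Q x = 0)"
  have Q: "Q \<in> poly_over K" "Q \<noteq> 0" "poly Q x = 0"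
    using arg_min_natI[of "\<lambda>Q. Q \<in> poly_over K \<and> Q \<noteq> 0 \<and> poly Q x = 0" P degree] P unfolding Q_def by auto
  have min: "degree Q \<le> degree Q'" if "Q' \<in> poly_over K \<and> Q' \<noteq> 0 \<and> poly Q' x = 0" for Q'
    unfolding Q_def by (rule arg_min_nat_le) (rule that)
  define g where "g = smult (inverse (lead_coeff Q)) Q"
  have "inverse (lead_coeff Q) \<in> K" using K Q by (auto simp: is_subfield_def coeff_poly_over)
  hence g: "g \<in> poly_over K" "lead_coeff g = 1" "poly g x = 0" "degree g = degree Q"
    using Q by (auto simp: g_def intro: poly_over_smult S)
  have "\<exists>h\<in>poly_over K. R = g * h" if R: "R \<in> poly_over K" "poly R x = 0" for R
  proof -
    have dm: "R div g \<in> poly_over K" "R mod g \<in> poly_over K"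
      using poly_over_div_mod[OF S g(1,2) R(1)] by auto
    have "degree g > 0"
      by (rule monic_root_degree_pos[OF g(2,3)])
    hence "R mod g = 0"
      using min[of "R mod g"] degree_mod_less_pos[of g R] dm(2) poly_mod_root[OF g(3), of R] R(2) g(4) by force
    hence "R = g * (R div g)" by (metis add.right_neutral mult.commute div_mult_mod_eq)
    thus ?thesis using dm by blast
  qed
  thus ?thesis using that[OF g(1-3)] min g(4) by auto
qed

text \<open>The minimal polynomial of a root of unity of order dividing \<open>m\<close> divides X ^
  m - 1. So it is integral by Gauss's lemma, and its roots lie on the unit circle, which bounds its
  coefficients independently of \<open>m\<close>. Its degree is at most \<open>card B\<close>, so
  only finitely many polynomials occur.\<close>

lemma finite_roots_of_unity_in_finite_span:
  fixes L :: "complex set"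
  assumes L: "subring_of L" and B: "finite B" "L \<subseteq> rat_vs.span B"
  shows "finite (torsion_units L)"
proof -
  let ?G = "{p :: int poly. degree p \<le> card B \<and> (\<forall>i. \<bar>coeff p i\<bar> \<le> 2 ^ card B)}"
  have "torsion_units L \<subseteq> (\<Union>p\<in>?G - {0}. {z. poly (map_poly of_int p) z = 0})"
  proof
    fix z assume "z \<in> torsion_units L"
    then obtain m where z: "z \<in> L" "z \<noteq> 0" "m > 0" "z ^ m = 1" by (auto simp: torsion_units_def)
    have "z ^ i \<in> rat_vs.span B" for i using subring_of_power[OF L z(1)] B by blast
    from rat_algebraic_if_powers_in_span[OF B(1) this] obtain P
      where P: "P \<in> poly_over \<rat>" "P \<noteq> 0" "degree P \<le> card B" "poly P z = 0" by blast
    from monic_minimal_poly[OF is_subfield_Rats P(1,2,4)] obtain g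
      where g: "g \<in> poly_over \<rat>" "lead_coeff g = 1" "poly g z = 0"
        and gmin: "\<And>Q. Q \<in> poly_over \<rat> \<Longrightarrow> poly Q z = 0 \<Longrightarrow> Q \<noteq> 0 \<Longrightarrow> degree g \<le> degree Q"
        and gdvd: "\<And>Q. Q \<in> poly_over \<rat> \<Longrightarrow> poly Q z = 0 \<Longrightarrow> \<exists>h\<in>poly_over \<rat>. Q = g * h"
      by blast
    have deg: "degree g \<le> card B" using gmin[OF P(1,4,2)] P(3) by simp
    define F where "F = (monom 1 m - 1 :: int poly)"
    have F: "map_poly of_int F = (monom 1 m - 1 :: complex poly)"
      by (rule poly_eqI) (simp add: F_def coeff_map_poly coeff_1)
    have lF: "lead_coeff (monom 1 m - 1 :: complex poly) = 1"
    proof -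
      have "degree (monom 1 m - 1 :: complex poly) \<le> m"
        by (intro degree_diff_le) (auto simp: degree_monom_eq)
      moreover have "coeff (monom 1 m - 1 :: complex poly) m = 1" using z(3) by (simp add: coeff_1)
      ultimately have "degree (monom 1 m - 1 :: complex poly) = m"
        by (metis le_antisym le_degree zero_neq_one)
      thus ?thesis using z(3) by (simp add: coeff_1)
    qed
    have "(monom 1 m - 1 :: complex poly) \<in> poly_over \<rat>"
      by (intro subring_ofD subring_of_poly_over poly_over_monom subring_of_Rats Rats_1)
    from gdvd[OF this] obtain h where h: "h \<in> poly_over \<rat>" "monom 1 m - 1 = g * h"
      using z(4) by (auto simp: poly_monom)
    have "lead_coeff h = 1" using lF g(2) unfolding h(2) lead_coeff_mult by simp
    from monic_factor_integral[OF g(1,2) h(1) this] obtain G where G: "g = map_poly of_int G"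
      using h(2) F by metis
    have norm1: "norm a \<le> 1" if "a \<in># proots g" for a
    proof -
      have "g \<noteq> 0" using g(2) by auto
      hence "poly g a = 0" using that by simp
      hence "poly (monom 1 m - 1) a = 0" unfolding h(2) by simp
      hence "a ^ m = 1" by (simp add: poly_monom)
      hence "norm a ^ m = 1 ^ m" by (metis norm_one norm_power power_one)
      hence "norm a = 1" by (rule power_eq_imp_eq_base) (use z(3) in auto)
      thus ?thesis by simp
    qed
    have "norm (coeff g i) \<le> 2 ^ card B" for i
    proof -
      have "norm (coeff g i) \<le> 2 ^ size (proots g)"
        using coeff_prod_linear_bound[of "proots g" i, OF norm1] complex_poly_decompose_multiset[of g] g(2) by simp
      also have "\<dots> \<le> 2 ^ card B" using deg by (simp add: size_proots_complex)
      finally show ?thesis .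
    qed
    hence "\<bar>coeff G i\<bar> \<le> 2 ^ card B" for i
      unfolding G by (simp add: coeff_map_poly) (metis of_int_le_iff of_int_abs of_int_numeral of_int_power)
    moreover have "degree G \<le> card B" using deg unfolding G by (simp add: degree_map_poly)
    moreover have "G \<noteq> 0" using g(2) G by auto
    ultimately show "z \<in> (\<Union>p\<in>?G - {0}. {z. poly (map_poly of_int p) z = 0})"
      using g(3) G by auto
  qed
  moreover have "finite (\<Union>p\<in>?G - {0}. {z::complex. poly (map_poly of_int p) z = 0})"
    by (intro finite_UN_I finite_Diff finite_bounded_int_polys poly_roots_finite)
       (auto simp: poly_eq_iff coeff_map_poly)
  ultimately show ?thesis by (rule finite_subset)
qed

text \<open>Lagrange's theorem, by comparing the product over the group with that over its translate
  by \<open>z\<close>. An infinite group has \<open>card\<close> 0, and then the claim is z ^ 0 =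
  1.\<close>

lemma torsion_units_power_card:
  assumes K: "is_subfield (K :: 'a::field_char_0 set)" and z: "z \<in> torsion_units K"
  shows "z ^ card (torsion_units K) = 1"
proof (cases "finite (torsion_units K)")
  case True
  let ?T = "torsion_units K"
  have z0: "z \<noteq> 0" using z by (simp add: torsion_units_def)
  have "x * y \<in> ?T" if xy: "x \<in> ?T" "y \<in> ?T" for x y
  proof -
    from xy obtain m n where "m > 0" "n > 0" "x ^ m = 1" "y ^ n = 1" by (auto simp: torsion_units_def)
    hence "m * n > 0" "(x * y) ^ (m * n) = 1"
      by (simp_all add: power_mult_distrib power_mult) (metis mult.commute power_mult power_one)
    moreover have "x * y \<in> K - {0}" using xy K by (auto simp: torsion_units_def is_subfield_def)
    ultimately show ?thesis unfolding torsion_units_def by blast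
  qed
  hence "(\<lambda>x. z * x) ` ?T \<subseteq> ?T" using z by auto
  moreover have inj: "inj_on (\<lambda>x. z * x) ?T" using z0 by (auto simp: inj_on_def)
  ultimately have eq: "(\<lambda>x. z * x) ` ?T = ?T" by (intro endo_inj_surj True)
  have "\<Prod>?T = (\<Prod>x\<in>?T. z * x)"
    by (subst eq[symmetric]) (simp add: prod.reindex[OF inj])
  also have "\<dots> = z ^ card ?T * \<Prod>?T" by (simp add: prod.distrib)
  finally have "\<Prod>?T = z ^ card ?T * \<Prod>?T" .
  moreover have "\<Prod>?T \<noteq> 0" using True by (auto simp: torsion_units_def prod_zero_iff)
  ultimately show ?thesis by simp
qed simp

section \<open>The minimal polynomial and the trace\<close>

abbreviation rat_poly :: "rat poly \<Rightarrow> 'a::field_char_0 poly" where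
  "rat_poly \<equiv> map_poly of_rat"

section \<open>Rational polynomials read in other fields of characteristic 0\<close>

lemma rat_poly_add: "rat_poly (p + q) = rat_poly p + rat_poly q"
  by (rule poly_eqI) (simp add: coeff_map_poly of_rat_add)

lemma rat_poly_diff: "rat_poly (p - q) = rat_poly p - rat_poly q"
  by (rule poly_eqI) (simp add: coeff_map_poly of_rat_diff)

lemma rat_poly_mult: "rat_poly (p * q) = rat_poly p * rat_poly q"
  by (rule poly_eqI) (simp add: coeff_mult coeff_map_poly of_rat_sum of_rat_mult)

lemma rat_poly_monom: "rat_poly (monom c n) = monom (of_rat c) n"
  by (simp add: map_poly_monom)

lemma rat_poly_eq_0_iff: "rat_poly p = 0 \<longleftrightarrow> p = 0"
  by (simp add: poly_eq_iff coeff_map_poly)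

lemma pderiv_rat_poly: "pderiv (rat_poly p) = rat_poly (pderiv p)"
  by (rule poly_eqI) (simp add: coeff_pderiv coeff_map_poly of_rat_mult of_rat_add)

lemma degree_rat_poly: "degree (rat_poly p) = degree p"
  by (simp add: degree_map_poly)

lemma rat_poly_over_Rats: "rat_poly p \<in> poly_over \<rat>"
  by (simp add: poly_over_def coeff_map_poly)

lemma poly_over_RatsE:
  assumes "P \<in> poly_over \<rat>"
  obtains p where "P = rat_poly p"
  using ratpolyE[of P] coeff_poly_over[OF assms] by blast

lemma poly_rat_poly_pcompose:
  "poly (rat_poly (pcompose p q)) x = poly (rat_poly p) (poly (rat_poly q) x)"
  by (induction p) (simp_all add: pcompose_pCons rat_poly_add rat_poly_mult map_poly_pCons)

lemma of_real_of_rat: "(of_real (of_rat q) :: complex) = of_rat q"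
  by (cases q) (simp add: of_rat_rat)

lemma poly_rat_poly_of_real: "poly (rat_poly p) (complex_of_real x) = of_real (poly (rat_poly p) x)"
  by (induction p) (simp_all add: map_poly_pCons of_real_of_rat)

text \<open>The minimal polynomial of \<open>x\<close> divides both and is associated to
  \<open>p\<close>. The conclusion concerns rational polynomials only, so relations pass from the
  real \<alpha> to its complex conjugates and back.\<close>

lemma irreducible_dvd_if_common_root:
  fixes x :: "'a::field_char_0"
  assumes p: "irreducible p" "poly (rat_poly p) x = 0" and q: "poly (rat_poly q) x = 0"
  shows "p dvd q"
proof -
  have p0: "p \<noteq> 0" using p by auto
  obtain g where g: "g \<in> poly_over \<rat>" "lead_coeff g = 1" "poly g x = 0"
    and gdvd: "\<And>Q. Q \<in> poly_over \<rat> \<Longrightarrow> poly Q x = 0 \<Longrightarrow> \<exists>h\<in>poly_over \<rat>. Q = g * h"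
    using monic_minimal_poly[OF is_subfield_Rats rat_poly_over_Rats _ p(2)] p0
    unfolding rat_poly_eq_0_iff by metis
  obtain g' where g': "g = rat_poly g'" using g(1) by (rule poly_over_RatsE)
  have dvd: "g' dvd r" if r: "poly (rat_poly r) x = 0" for r
  proof -
    obtain h where h: "h \<in> poly_over \<rat>" "rat_poly r = g * h" using gdvd[OF rat_poly_over_Rats r] by blast
    obtain h' where h': "h = rat_poly h'" using h(1) by (rule poly_over_RatsE)
    have "rat_poly (r - g' * h') = (0 :: 'a poly)" using h g' h' by (simp add: rat_poly_diff rat_poly_mult)
    thus ?thesis by (simp add: rat_poly_eq_0_iff)
  qed
  obtain h where h: "p = g' * h" using dvd[OF p(2)] by blast
  have "g' \<noteq> 0" using h p0 by auto
  moreover have "degree g' > 0" using monic_root_degree_pos[OF g(2,3)] g' by (simp add: degree_rat_poly)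
  ultimately have "\<not> g' dvd 1" using is_unit_iff_degree[of g'] by simp
  hence "h dvd 1" using irreducibleD[OF p(1) h] by blast
  hence "p dvd g'" unfolding h by simp
  thus ?thesis using dvd[OF q] by (rule dvd_trans)
qed

lemma irreducible_root_degree_less:
  assumes "irreducible p" "poly (rat_poly p) (x::'a::field_char_0) = 0" "poly (rat_poly q) x = 0"
    "degree q < degree p"
  shows "q = 0"
  using irreducible_dvd_if_common_root[OF assms(1-3)] dvd_imp_degree_le[of p q] assms(4) by auto

text \<open>Justifies the definite description. A monic polynomial of least degree is irreducible
  because any factor vanishing at \<open>x\<close> already has full degree; two candidates divide
  each other.\<close>

lemma rat_min_poly:
  fixes x :: "'a::field_char_0"
  assumes "algebraic x"
  shows "lead_coeff (rat_min_poly x) = 1" "irreducible (rat_min_poly x)"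
    "poly (rat_poly (rat_min_poly x)) x = 0"
proof -
  from assms obtain P0 where "\<forall>i. coeff P0 i \<in> \<int>" "P0 \<noteq> 0" "poly P0 x = 0"
    unfolding algebraic_def by blast
  hence P: "P0 \<in> poly_over \<rat>" "P0 \<noteq> 0" "poly P0 x = 0"
    using Ints_subset_Rats by (auto simp: poly_over_def)
  obtain g
    where g: "g \<in> poly_over \<rat>" "lead_coeff g = 1" "poly g x = 0"
    and gmin: "\<And>Q. Q \<in> poly_over \<rat> \<Longrightarrow> poly Q x = 0 \<Longrightarrow> Q \<noteq> 0 \<Longrightarrow> degree g \<le> degree Q"
    using monic_minimal_poly[OF is_subfield_Rats P] by metis
  obtain p where p: "g = rat_poly p" using g(1) by (rule poly_over_RatsE)
  have lc: "lead_coeff p = 1" using g(2) unfolding p by (simp add: degree_rat_poly coeff_map_poly)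
  have root: "poly (rat_poly p) x = 0" using g(3) p by simp
  have p0: "p \<noteq> 0" using lc by auto
  have deg: "degree p > 0" using monic_root_degree_pos[OF g(2,3)] p by (simp add: degree_rat_poly)
  have unit: "a dvd 1" if ab: "p = a * b" "poly (rat_poly b) x = 0" for a b
  proof -
    have ab0: "a \<noteq> 0" "b \<noteq> 0" using p0 ab by auto
    have "degree p \<le> degree b"
      using gmin[OF rat_poly_over_Rats ab(2)] ab0 p by (simp add: rat_poly_eq_0_iff degree_rat_poly)
    hence "degree a = 0" using ab ab0 by (simp add: degree_mult_eq)
    thus ?thesis using ab0 is_unit_iff_degree by blast
  qed
  have irr: "irreducible p"
  proof (rule irreducibleI)
    show "p \<noteq> 0" by (rule p0)
    show "\<not> p dvd 1" using deg is_unit_iff_degree[OF p0] by simp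
  next
    fix a b assume ab: "p = a * b"
    have "poly (rat_poly a) x = 0 \<or> poly (rat_poly b) x = 0"
      using root unfolding ab by (simp add: rat_poly_mult)
    thus "a dvd 1 \<or> b dvd 1" using unit[of a b] unit[of b a] ab by (auto simp: mult.commute)
  qed
  have "lead_coeff (rat_min_poly x) = 1 \<and> irreducible (rat_min_poly x) \<and> poly (rat_poly (rat_min_poly x)) x = 0"
    unfolding rat_min_poly_def
  proof (rule theI[of _ p])
    show "lead_coeff p = 1 \<and> irreducible p \<and> poly (rat_poly p) x = 0" using lc irr root by blast
  next
    fix q assume q: "lead_coeff q = 1 \<and> irreducible q \<and> poly (rat_poly q) x = 0"
    have "p dvd q" "q dvd p"
      using irreducible_dvd_if_common_root irr root q by blast+
    moreover have "q \<noteq> 0" using q by auto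
    ultimately have "degree q = degree p" using p0 by (intro antisym dvd_imp_degree_le)
    hence "degree (q - p) \<le> degree p" "coeff (q - p) (degree p) = 0"
      using q lc by (auto intro: degree_diff_le)
    hence "q - p = 0 \<or> degree (q - p) < degree p"
      by (metis leading_coeff_0_iff order_le_less)
    thus "q = p"
      using irreducible_root_degree_less[OF irr root, of "q - p"] q root by (auto simp: rat_poly_diff)
  qed
  thus "lead_coeff (rat_min_poly x) = 1" "irreducible (rat_min_poly x)"
    "poly (rat_poly (rat_min_poly x)) x = 0" by blast+
qed

text \<open>Separability in characteristic 0: the derivative is nonzero of smaller degree, so
  \<open>f\<close> shares no root with it.\<close>

lemma card_complex_roots_irreducible:
  assumes f: "irreducible f" "lead_coeff f = 1"
  shows "card {z :: complex. poly (rat_poly f) z = 0} = degree f"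
proof -
  have "f \<noteq> 0" using f by auto
  have "degree f > 0" using f \<open>f \<noteq> 0\<close> is_unit_iff_degree irreducible_def by blast
  hence d: "pderiv f \<noteq> 0" "degree (pderiv f) < degree f"
    by (auto simp: pderiv_eq_0_iff degree_pderiv)
  have "\<not> (poly (rat_poly f) a = 0 \<and> poly (pderiv (rat_poly f)) a = 0)" for a :: complex
    using irreducible_root_degree_less[OF f(1) _ _ d(2), of a] d(1) by (auto simp: pderiv_rat_poly)
  hence "rsquarefree (rat_poly f :: complex poly)" by (auto simp: rsquarefree_roots)
  from complex_poly_decompose_rsquarefree[OF this]
  have "(\<Prod>z | poly (rat_poly f) z = 0. [:- z, 1:]) = (rat_poly f :: complex poly)"
    using f(2) by (simp add: degree_rat_poly coeff_map_poly)
  hence "degree (rat_poly f :: complex poly) = degree (\<Prod>z :: complex | poly (rat_poly f) z = 0. [:- z, 1:])" by simp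
  also have "\<dots> = card {z :: complex. poly (rat_poly f) z = 0}"
    by (subst degree_prod_eq_sum_degree) auto
  finally show ?thesis by (simp add: degree_rat_poly)
qed

lemma rat_adjoin_subset_span_powers:
  fixes x :: "'a::field_char_0"
  assumes f: "f \<in> poly_over \<rat>" "lead_coeff f = 1" "poly f x = 0"
  shows "rat_adjoin {x} \<subseteq> rat_vs.span ((\<lambda>i. x ^ i) ` {..<degree f})"
proof -
  let ?V = "(\<lambda>P. poly P x) ` poly_over \<rat>" and ?B = "(\<lambda>i. x ^ i) ` {..<degree f}"
  have B: "(\<lambda>(b, i). b * x ^ i) ` ({1} \<times> {..<degree f}) = ?B" by force
  have V: "?V \<subseteq> rat_vs.span ?B"
    using poly_values_subset_span[OF subring_of_Rats order.refl Rats_subset_span_1 f] unfolding B .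
  have sup: "insert x \<rat> \<subseteq> ?V" by (rule poly_values_superset[OF subring_of_Rats])
  have "is_subfield ?V"
    by (rule is_subfield_if_finite_span[OF subring_of_poly_values[OF subring_of_Rats] _ _ V])
       (use sup in auto)
  hence "rat_adjoin {x} \<subseteq> ?V" using sup by (intro rat_adjoin_minimal) auto
  thus ?thesis using V by blast
qed

text \<open>The ring generated by \<open>y\<close> lies in the finite-dimensional field generated by
  \<open>x\<close>, hence is a field. This is what allows \<alpha> to be written as a rational
  polynomial in \<alpha> ^ h.\<close>

lemma rat_adjoin_subset_poly_values:
  fixes x :: "'a::field_char_0"
  assumes f: "f \<in> poly_over \<rat>" "lead_coeff f = 1" "poly f x = 0" and y: "y \<in> rat_adjoin {x}"
  shows "rat_adjoin {y} \<subseteq> (\<lambda>P. poly P y) ` poly_over \<rat>"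
proof -
  let ?V = "(\<lambda>P. poly P y) ` poly_over \<rat>" and ?B = "(\<lambda>i. x ^ i) ` {..<degree f}"
  note K = is_subfield_rat_adjoin[of "{x}"]
  have "?V \<subseteq> rat_adjoin {x}"
    using poly_poly_over[OF subring_of_subfield[OF K] poly_over_mono[OF _ Rats_subset_subfield[OF K]] y] by auto
  hence V: "?V \<subseteq> rat_vs.span ?B" using rat_adjoin_subset_span_powers[OF f] by blast
  have sup: "insert y \<rat> \<subseteq> ?V" by (rule poly_values_superset[OF subring_of_Rats])
  have "is_subfield ?V"
    by (rule is_subfield_if_finite_span[OF subring_of_poly_values[OF subring_of_Rats] _ _ V])
       (use sup in auto)
  thus ?thesis using sup by (intro rat_adjoin_minimal) auto
qed

text \<open>In the basis of powers of \<open>x\<close> the diagonal entries are coefficients of X ^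
  (n + b) modulo the minimal polynomial; \<open>trace_eq_sum_values\<close> turns them into a sum
  over its complex roots.\<close>

lemma of_rat_field_trace_power:
  fixes x :: "'a::field_char_0"
  assumes "algebraic x"
  shows "of_rat (field_trace (rat_adjoin {x}) (x ^ n)) =
           (\<Sum>z | poly (rat_poly (rat_min_poly x)) z = 0. z ^ n :: complex)"
proof -
  define f where "f = rat_min_poly x"
  define d where "d = degree f"
  define K where "K = rat_adjoin {x}"
  define B where "B = (\<lambda>i. x ^ i) ` {..<d}"
  have f: "lead_coeff f = 1" "irreducible f" "poly (rat_poly f) x = 0"
    unfolding f_def using rat_min_poly[OF assms] by blast+
  have lcf: "lead_coeff (rat_poly f :: 'b::field_char_0 poly) = 1"
    using f(1) by (simp add: degree_rat_poly coeff_map_poly)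
  have d0: "d > 0" using monic_root_degree_pos[OF lcf f(3)] by (simp add: d_def degree_rat_poly)
  have K: "is_subfield K" unfolding K_def by (rule is_subfield_rat_adjoin)
  have xK: "x ^ i \<in> K" for i
    using rat_adjoin_superset[of "{x}"] by (intro subring_of_power subring_of_subfield K) (auto simp: K_def)
  have zero: "c i = 0" if "(\<Sum>i<d. of_rat (c i) * x ^ i) = 0" "i < d" for c i
  proof -
    define q where "q = (\<Sum>i<d. monom (c i) i)"
    have coeffq: "coeff q i = (if i < d then c i else 0)" for i by (simp add: q_def coeff_sum)
    have "degree q < d" using d0 coeffq by (intro degree_lessI) auto
    moreover have "poly (rat_poly q) x = 0"
      using that(1) \<open>degree q < d\<close> poly_sum_lessThan[of "rat_poly q" d x]
      by (simp add: degree_rat_poly coeff_map_poly coeffq)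
    ultimately have "q = 0" using irreducible_root_degree_less[OF f(2,3)] d_def by blast
    thus ?thesis using coeffq[of i] that(2) by simp
  qed
  \<comment> \<open>The basis is a set, so sums over it become sums over exponents only once the
    powers are known to be distinct.\<close>
  have inj: "inj_on (\<lambda>i. x ^ i) {..<d}"
  proof (rule inj_onI, rule ccontr)
    fix i j assume ij: "i \<in> {..<d}" "j \<in> {..<d}" "x ^ i = x ^ j" "i \<noteq> j"
    define c :: "nat \<Rightarrow> rat" where "c k = (if k = i then 1 else 0) - (if k = j then 1 else 0)" for k
    have "(\<Sum>k<d. of_rat (c k) * x ^ k) = (\<Sum>k<d. (if k = i then x ^ k else 0) - (if k = j then x ^ k else 0))"
      by (rule sum.cong) (auto simp: c_def of_rat_diff)
    also have "\<dots> = 0" using ij by (simp add: sum_subtractf)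
    finally have "c i = 0" using zero[of c i] ij by simp
    thus False using ij by (simp add: c_def)
  qed
  have finB: "finite B" by (simp add: B_def)
  have ind: "rat_vs.independent B"
  proof (rule rat_vs.independent_if_scalars_zero[OF finB])
    fix u v assume "(\<Sum>v\<in>B. of_rat (u v) * v) = 0" "v \<in> B"
    thus "u v = 0" using zero[of "\<lambda>i. u (x ^ i)"] by (auto simp: B_def sum.reindex[OF inj])
  qed
  have span: "rat_vs.span B = K"
  proof
    have "rat_vs.subspace K"
    proof (rule rat_vs.subspaceI)
      fix c and y assume "y \<in> K"
      moreover have "of_rat c \<in> K" using Rats_subset_subfield[OF K] by auto
      ultimately show "of_rat c * y \<in> K" using K by (auto simp: is_subfield_def)
    qed (use K in \<open>auto simp: is_subfield_def\<close>)
    moreover have "B \<subseteq> K" using xK by (auto simp: B_def)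
    ultimately show "rat_vs.span B \<subseteq> K" by (rule rat_vs.span_minimal[rotated])
    show "K \<subseteq> rat_vs.span B"
      unfolding K_def B_def d_def degree_rat_poly[of f, where 'a='a, symmetric]
      by (rule rat_adjoin_subset_span_powers[OF rat_poly_over_Rats lcf f(3)])
  qed
  have rep: "rat_vs.representation B (\<Sum>i<d. of_rat (c i) * x ^ i) (x ^ b) = c b" if "b < d" for c b
  proof -
    have base: "x ^ i \<in> rat_vs.span B" if "i < d" for i
      using that by (intro rat_vs.span_base) (auto simp: B_def)
    have "rat_vs.representation B (\<Sum>i<d. of_rat (c i) * x ^ i) (x ^ b)
        = (\<Sum>i<d. rat_vs.representation B (of_rat (c i) * x ^ i) (x ^ b))"
      by (subst rat_vs.representation_sum[OF ind]) (auto intro: rat_vs.span_scale base)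
    also have "\<dots> = (\<Sum>i<d. if i = b then c i else 0)"
    proof (rule sum.cong)
      fix i assume i: "i \<in> {..<d}"
      have "x ^ i \<in> B" using i by (auto simp: B_def)
      thus "rat_vs.representation B (of_rat (c i) * x ^ i) (x ^ b) = (if i = b then c i else 0)"
        using i that inj
        by (subst rat_vs.representation_scale[OF ind]) (auto simp: base rat_vs.representation_basis[OF ind] inj_on_def)
    qed simp
    also have "\<dots> = c b" using that by simp
    finally show ?thesis .
  qed
  define r where "r b = monom 1 (n + b) mod f" for b
  have degr: "degree (r b) < d" for b unfolding r_def d_def by (rule degree_mod_less_pos) (use d0 d_def in simp)
  \<comment> \<open>Valid in every field of characteristic 0: it is used at \<open>x\<close> for the
    matrix entries and at the complex roots for the power sum.\<close>
  have rval: "poly (rat_poly (r b)) z = z ^ (n + b)" if "poly (rat_poly f) z = 0" for b and z :: "'b::field_char_0"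
  proof -
    have "rat_poly (monom 1 (n + b)) = rat_poly (monom 1 (n + b) div f) * rat_poly f + (rat_poly (r b) :: 'b poly)"
      unfolding r_def rat_poly_mult[symmetric] rat_poly_add[symmetric] by simp
    from arg_cong[OF this, of "\<lambda>P. poly P z"] show ?thesis
      using that by (simp add: rat_poly_monom poly_monom)
  qed
  have "field_trace K (x ^ n) = (\<Sum>v\<in>B. rat_vs.representation B (x ^ n * v) v)"
    by (rule field_trace_basis[OF finB ind span]) (use K xK in \<open>auto simp: is_subfield_def\<close>)
  also have "\<dots> = (\<Sum>b<d. rat_vs.representation B (x ^ n * x ^ b) (x ^ b))"
    by (simp add: B_def sum.reindex[OF inj])
  also have "\<dots> = (\<Sum>b<d. coeff (r b) b)"
  proof (rule sum.cong)
    fix b assume b: "b \<in> {..<d}"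
    have "x ^ n * x ^ b = (\<Sum>i<d. of_rat (coeff (r b) i) * x ^ i)"
      using rval[OF f(3), of b] poly_sum_lessThan[of "rat_poly (r b)" d x] degr[of b]
      by (simp add: degree_rat_poly coeff_map_poly power_add)
    thus "rat_vs.representation B (x ^ n * x ^ b) (x ^ b) = coeff (r b) b"
      using rep[of b "coeff (r b)"] b by simp
  qed simp
  finally have "(of_rat (field_trace K (x ^ n)) :: complex) = (\<Sum>b<d. coeff (rat_poly (r b)) b)"
    by (simp add: of_rat_sum coeff_map_poly)
  also have "\<dots> = (\<Sum>z | poly (rat_poly f) z = 0. z ^ n)"
  proof (rule trace_eq_sum_values)
    show "finite {z :: complex. poly (rat_poly f) z = 0}"
      using f(1) by (intro poly_roots_finite) (auto simp: rat_poly_eq_0_iff)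
    show "card {z :: complex. poly (rat_poly f) z = 0} = d"
      unfolding d_def by (rule card_complex_roots_irreducible[OF f(2,1)])
  qed (use degr rval in \<open>auto simp: degree_rat_poly power_add mult.commute\<close>)
  finally show ?thesis unfolding K_def f_def .
qed

section \<open>The two implications\<close>

text \<open>If \<open>\<alpha> = g (\<alpha> ^ h)\<close>, then \<open>z = g (z ^ h)\<close> for every conjugate \<open>z\<close>. Hence \<open>\<alpha>\<close> is the only
  conjugate with a given \<open>N\<close>-th power, and evaluating a suitable combination of the vanishing power
  sums isolates the term \<open>\<alpha> ^ a\<close>.\<close>

lemma finite_power_sum_zeros:
  fixes \<alpha> :: real and f :: "rat poly"
  assumes f: "irreducible f" "lead_coeff f = 1" "poly (rat_poly f) \<alpha> = 0" and \<alpha>: "\<alpha> \<noteq> 0"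
    and h: "h = card (torsion_units (splitting_field f))" and gen: "\<alpha> \<in> rat_adjoin {\<alpha> ^ h}"
  shows "finite {n. (\<Sum>z | poly (rat_poly f) z = 0. z ^ n :: complex) = 0}"
proof (rule ccontr)
  define Z where "Z = {z :: complex. poly (rat_poly f) z = 0}"
  assume "infinite {n. (\<Sum>z | poly (rat_poly f) z = 0. z ^ n :: complex) = 0}"
  hence inf: "infinite {n. (\<Sum>z\<in>Z. z ^ n) = 0}" by (simp add: Z_def)
  have f0: "f \<noteq> 0" using f(2) by auto
  have finZ: "finite Z" unfolding Z_def using f0 by (intro poly_roots_finite) (simp add: rat_poly_eq_0_iff)
  have cardZ: "card Z = degree (rat_poly f :: complex poly)"
    unfolding Z_def degree_rat_poly by (rule card_complex_roots_irreducible[OF f(1,2)])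
  have lcf: "lead_coeff (rat_poly f :: 'b::field_char_0 poly) = 1"
    using f(2) by (simp add: degree_rat_poly coeff_map_poly)
  have conj: "poly (rat_poly q) z = 0" if z: "z \<in> Z" and q: "poly (rat_poly q) \<alpha> = 0" for q z
  proof -
    obtain r where "q = f * r" using irreducible_dvd_if_common_root[OF f(1,3) q] by blast
    thus ?thesis using z by (simp add: Z_def rat_poly_mult)
  qed
  have \<alpha>Z: "complex_of_real \<alpha> \<in> Z" using f(3) by (simp add: Z_def poly_rat_poly_of_real)
  \<comment> \<open>A complex root 0 would make \<open>f\<close> divide X, and evaluating at the
    real \<alpha> would give \<alpha> = 0.\<close>
  have Z0: "coeff (rat_poly f :: complex poly) 0 \<noteq> 0"
  proof
    assume "coeff (rat_poly f :: complex poly) 0 = 0"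
    hence "poly (rat_poly f) (0 :: complex) = 0" by (simp add: poly_0_coeff_0)
    hence "f dvd [:0, 1:]"
      by (rule irreducible_dvd_if_common_root[OF f(1)]) (simp add: map_poly_pCons)
    then obtain r where "[:0, 1:] = f * r" by blast
    hence "poly (rat_poly [:0, 1:]) \<alpha> = 0" using f(3) by (simp add: rat_poly_mult)
    thus False using \<alpha> by (simp add: map_poly_pCons)
  qed
  have K: "is_subfield (splitting_field f)" unfolding splitting_field_def by (rule is_subfield_rat_adjoin)
  have ZK: "Z \<subseteq> splitting_field f" unfolding splitting_field_def Z_def by (rule rat_adjoin_superset)
  have "\<alpha> ^ h \<in> rat_adjoin {\<alpha>}"
    using rat_adjoin_superset[of "{\<alpha>}"]
    by (intro subring_of_power subring_of_subfield is_subfield_rat_adjoin) auto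
  from rat_adjoin_subset_poly_values[OF rat_poly_over_Rats lcf f(3) this] gen
  obtain G where G: "G \<in> poly_over \<rat>" "\<alpha> = poly G (\<alpha> ^ h)" by auto
  obtain g where g: "G = rat_poly g" using G(1) by (rule poly_over_RatsE)
  \<comment> \<open>The relation \<alpha> = g(\<alpha> ^ h) says that \<alpha> is a root of the
    rational polynomial g(X ^ h) - X, hence so is every conjugate.\<close>
  have zg: "z = poly (rat_poly g) (z ^ h)" if "z \<in> Z" for z
    using conj[OF that, of "pcompose g (monom 1 h) - monom 1 1"] G(2) g
    by (simp add: rat_poly_diff poly_rat_poly_pcompose rat_poly_monom poly_monom)
  obtain a N where N: "N > 0" and zero: "\<And>k. (\<Sum>z\<in>Z. z ^ (a + N * k)) = 0"
    using power_sums_zero_progression[OF rat_poly_over_Rats lcf Z0 finZ cardZ _ inf] by (auto simp: Z_def)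
  let ?\<alpha> = "complex_of_real \<alpha>"
  have unique: "z = ?\<alpha>" if z: "z \<in> Z" "z ^ N = ?\<alpha> ^ N" for z
  proof -
    define \<zeta> where "\<zeta> = z / ?\<alpha>"
    have "\<zeta> ^ N = 1" using z(2) \<alpha> by (simp add: \<zeta>_def power_divide)
    moreover have "\<zeta> \<in> splitting_field f"
      using z(1) \<alpha>Z ZK K unfolding \<zeta>_def divide_inverse is_subfield_def by blast
    moreover have "\<zeta> \<noteq> 0" using calculation(1) N by (metis power_0_left neq0_conv zero_neq_one)
    ultimately have "\<zeta> \<in> torsion_units (splitting_field f)" using N by (auto simp: torsion_units_def)
    from torsion_units_power_card[OF K this] have "\<zeta> ^ h = 1" by (simp add: h)
    hence "z ^ h = ?\<alpha> ^ h" using \<alpha> by (simp add: \<zeta>_def power_divide)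
    thus ?thesis using zg[OF z(1)] zg[OF \<alpha>Z] by simp
  qed
  \<comment> \<open>\<open>P\<close> vanishes at every N-th power of a conjugate except \<alpha> ^
    N. Its coefficients weight the vanishing sums, in place of inverting a Vandermonde
    matrix.\<close>
  define P where "P = (\<Prod>w\<in>(\<lambda>z. z ^ N) ` Z - {?\<alpha> ^ N}. [:- w, 1:])"
  have "poly P (z ^ N) = 0" if "z \<in> Z - {?\<alpha>}" for z
  proof -
    have "z ^ N \<in> (\<lambda>z. z ^ N) ` Z - {?\<alpha> ^ N}" using that unique by auto
    thus ?thesis using finZ by (auto simp: P_def poly_prod)
  qed
  hence "(\<Sum>z\<in>Z. poly P (z ^ N) * z ^ a) = poly P (?\<alpha> ^ N) * ?\<alpha> ^ a"
    using sum.remove[OF finZ \<alpha>Z, of "\<lambda>z. poly P (z ^ N) * z ^ a"] by simp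
  moreover have "poly P (?\<alpha> ^ N) \<noteq> 0" using finZ by (auto simp: P_def poly_prod)
  moreover have "(\<Sum>z\<in>Z. poly P (z ^ N) * z ^ a) = (\<Sum>i\<le>degree P. coeff P i * (\<Sum>z\<in>Z. z ^ (a + N * i)))"
    unfolding poly_altdef sum_distrib_right sum_distrib_left power_add power_mult
    by (subst sum.swap) (simp add: mult_ac)
  ultimately show False using zero \<alpha> by simp
qed

section \<open>Vanishing power sums when \<alpha> is outside the field generated by \<alpha> ^
  h\<close>

lemma norm_coeff_0_prod_linear:
  fixes A :: "complex multiset"
  assumes "\<And>a. a \<in># A \<Longrightarrow> norm a = r"
  shows "norm (coeff (\<Prod>a\<in>#A. [:- a, 1:]) 0) = r ^ size A"
  using assms by (induction A) (auto simp: norm_mult)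

text \<open>The constant coefficient of the minimal polynomial of \<open>\<alpha>\<close> over a real field is, up to sign, a
  power of \<open>\<alpha>\<close>, because all roots of \<open>X ^ h - \<alpha> ^ h\<close> have absolute value \<open>\<alpha>\<close>.\<close>

lemma power_mem_if_root:
  fixes \<alpha> :: real
  assumes K: "is_subfield K" and \<alpha>: "\<alpha> > 0" and h: "h > 0" "\<alpha> ^ h \<in> K"
    and Q: "Q \<in> poly_over K" "Q \<noteq> 0" "poly Q \<alpha> = 0"
  shows "\<exists>m>0. m \<le> degree Q \<and> \<alpha> ^ m \<in> K"
proof -
  note S = subring_of_subfield[OF K]
  obtain g where g: "g \<in> poly_over K" "lead_coeff g = 1" "poly g \<alpha> = 0"
    and gmin: "\<And>Q. Q \<in> poly_over K \<Longrightarrow> poly Q \<alpha> = 0 \<Longrightarrow> Q \<noteq> 0 \<Longrightarrow> degree g \<le> degree Q"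
    and gdvd: "\<And>Q. Q \<in> poly_over K \<Longrightarrow> poly Q \<alpha> = 0 \<Longrightarrow> \<exists>r\<in>poly_over K. Q = g * r"
    using monic_minimal_poly[OF K Q] by metis
  define P where "P = monom 1 h - monom (\<alpha> ^ h) 0"
  have "P \<in> poly_over K" unfolding P_def
    by (intro subring_ofD(6)[OF subring_of_poly_over[OF S]] poly_over_monom S h subring_ofD(2)[OF S])
  from gdvd[OF this] obtain r where r: "P = g * r" by (auto simp: P_def poly_monom)
  \<comment> \<open>Passing to the complex numbers makes \<open>g\<close> split into linear
    factors.\<close>
  define c where "c = (map_poly complex_of_real :: real poly \<Rightarrow> _)"
  have cm: "c (p * q) = c p * c q" for p q
    by (rule poly_eqI) (simp add: c_def coeff_mult coeff_map_poly)
  have cP: "c P = monom 1 h - monom (complex_of_real \<alpha> ^ h) 0"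
    by (rule poly_eqI) (simp add: P_def c_def coeff_map_poly)
  have degc: "degree (c g) = degree g" by (simp add: c_def degree_map_poly)
  have lcc: "lead_coeff (c g) = 1" using g(2) by (simp add: degc) (simp add: c_def coeff_map_poly)
  have "norm a = \<alpha>" if "a \<in># proots (c g)" for a
  proof -
    have "c g \<noteq> 0" using lcc by auto
    hence "poly (c g) a = 0" using that by simp
    hence "poly (c P) a = 0" by (simp add: r cm)
    hence "a ^ h = complex_of_real \<alpha> ^ h" by (simp add: cP poly_monom)
    hence "norm a ^ h = \<alpha> ^ h" using \<alpha> by (metis norm_power norm_of_real abs_of_pos)
    thus ?thesis by (rule power_eq_imp_eq_base) (use \<alpha> h in auto)
  qed
  from norm_coeff_0_prod_linear[of "proots (c g)" \<alpha>, OF this]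
  have "norm (coeff (c g) 0) = \<alpha> ^ degree g"
    using complex_poly_decompose_multiset[of "c g"] lcc by (simp add: size_proots_complex degc)
  hence "\<bar>coeff g 0\<bar> = \<alpha> ^ degree g" by (simp add: c_def coeff_map_poly)
  moreover have "\<bar>coeff g 0\<bar> \<in> K"
    using coeff_poly_over[OF g(1), of 0] subring_ofD(5)[OF S] by (auto simp: abs_if)
  ultimately show ?thesis
    using monic_root_degree_pos[OF g(2,3)] gmin[OF Q(1,3,2)] by (intro exI[of _ "degree g"]) auto
qed

text \<open>Exponents are grouped by their residue \<open>r\<close> modulo \<open>e\<close>; each
  inner sum involves \<open>x\<close> only through \<open>x ^ e\<close>.\<close>

lemma poly_eq_sum_residues:
  fixes P :: "'a::comm_ring_1 poly"
  assumes "e > 0" "degree P < n * e"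
  shows "poly P x = (\<Sum>r<e. (\<Sum>q<n. coeff P (q * e + r) * (x ^ e) ^ q) * x ^ r)"
proof -
  have "poly P x = (\<Sum>j<n * e. coeff P j * x ^ j)" by (rule poly_sum_lessThan[OF assms(2)])
  also have "\<dots> = (\<Sum>q<n. \<Sum>j\<in>{q*e..<q*e+e}. coeff P j * x ^ j)" by (rule sum.nat_group[symmetric])
  also have "\<dots> = (\<Sum>q<n. \<Sum>r<e. coeff P (q * e + r) * x ^ (q * e + r))"
  proof (rule sum.cong)
    fix q
    show "(\<Sum>j\<in>{q*e..<q*e+e}. coeff P j * x ^ j) = (\<Sum>r<e. coeff P (q * e + r) * x ^ (q * e + r))"
      by (rule sum.reindex_bij_witness[of _ "\<lambda>r. q * e + r" "\<lambda>j. j - q * e"]) auto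
  qed simp
  also have "\<dots> = (\<Sum>r<e. \<Sum>q<n. coeff P (q * e + r) * x ^ (q * e + r))" by (rule sum.swap)
  also have "\<dots> = (\<Sum>r<e. (\<Sum>q<n. coeff P (q * e + r) * (x ^ e) ^ q) * x ^ r)"
    by (simp add: sum_distrib_left power_add mult_ac flip: power_mult)
  finally show ?thesis .
qed

text \<open>Let \<open>e\<close> be minimal with \<open>\<alpha> ^ e\<close> in \<open>\<rat>(\<alpha> ^ h)\<close>. Since \<open>1, \<alpha>, \<dots>, \<alpha> ^ (e - 1)\<close> are linearly
  independent over this field, the minimal polynomial of \<open>\<alpha>\<close> is a polynomial in \<open>X ^ e\<close>.\<close>

lemma infinite_power_sum_zeros:
  fixes \<alpha> :: real and f :: "rat poly"
  assumes f: "irreducible f" "lead_coeff f = 1" "poly (rat_poly f) \<alpha> = 0" and \<alpha>: "\<alpha> > 0"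
    and h: "h > 0" and gen: "\<alpha> \<notin> rat_adjoin {\<alpha> ^ h}"
  shows "infinite {n. (\<Sum>z | poly (rat_poly f) z = 0. z ^ n :: complex) = 0}"
proof -
  define K where "K = rat_adjoin {\<alpha> ^ h}"
  have K: "is_subfield K" unfolding K_def by (rule is_subfield_rat_adjoin)
  note S = subring_of_subfield[OF K]
  have hK: "\<alpha> ^ h \<in> K" using rat_adjoin_superset[of "{\<alpha> ^ h}"] by (simp add: K_def)
  define e where "e = (LEAST e. e > 0 \<and> \<alpha> ^ e \<in> K)"
  have e: "e > 0" "\<alpha> ^ e \<in> K" using LeastI[of "\<lambda>e. e > 0 \<and> \<alpha> ^ e \<in> K" h] h hK by (auto simp: e_def)
  have emin: "e \<le> m" if "m > 0" "\<alpha> ^ m \<in> K" for m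
    unfolding e_def by (rule Least_le) (use that in simp)
  have "e \<noteq> 1" using e(2) gen by (auto simp: K_def)
  hence e2: "e \<ge> 2" using e(1) by simp
  define n where "n = Suc (degree f)"
  have "n * 1 \<le> n * e" by (rule mult_le_mono2) (use e(1) in simp)
  hence fn: "degree f < n * e" by (simp add: n_def)
  define c where "c r = (\<Sum>q<n. coeff (rat_poly f) (q * e + r) * (\<alpha> ^ e) ^ q)" for r
  have cK: "c r \<in> K" for r unfolding c_def
    using Rats_subset_subfield[OF K]
    by (intro subring_of_sum S subring_ofD(4)[OF S] subring_of_power e) (auto simp: coeff_map_poly)
  \<comment> \<open>Otherwise the \<open>c r\<close> form a nonzero polynomial over \<open>K\<close>
    of degree below \<open>e\<close> vanishing at \<alpha>, and \<open>power_mem_if_root\<close>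
    yields a positive exponent below \<open>e\<close>.\<close>
  have c0: "c r = 0" if r: "r < e" for r
  proof (rule ccontr)
    assume cr: "c r \<noteq> 0"
    define Q where "Q = (\<Sum>r<e. monom (c r) r)"
    have coeffQ: "coeff Q i = (if i < e then c i else 0)" for i by (simp add: Q_def coeff_sum)
    have "Q \<in> poly_over K" using cK subring_ofD(1)[OF S] by (auto simp: poly_over_def coeffQ)
    moreover have "Q \<noteq> 0" using coeffQ[of r] cr r by auto
    moreover have "poly Q \<alpha> = 0"
      using f(3) poly_eq_sum_residues[of e "rat_poly f" n \<alpha>] fn e(1)
      by (simp add: Q_def poly_sum poly_monom c_def degree_rat_poly)
    ultimately obtain m where "m > 0" "m \<le> degree Q" "\<alpha> ^ m \<in> K"
      using power_mem_if_root[OF K \<alpha> h hK] by blast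
    moreover have "degree Q < e" using e(1) by (intro degree_lessI) (auto simp: coeffQ)
    ultimately show False using emin[of m] by simp
  qed
  have coeff0: "coeff f j = 0" if j: "\<not> e dvd j" for j
  proof -
    define r where "r = j mod e"
    have r: "0 < r" "r < e" using j e(1) by (auto simp: r_def mod_greater_zero_iff_not_dvd)
    \<comment> \<open>The part of \<open>f\<close> with exponents congruent to \<open>r\<close>,
      shifted down by \<open>r\<close>. Since \<open>r > 0\<close> its degree drops below that of
      \<open>f\<close>, while its value at \<alpha> is \<open>c r\<close>, that is 0.\<close>
    define H where "H = (\<Sum>q<n. monom (coeff f (q * e + r)) (q * e))"
    have coeffH: "coeff H i = (if e dvd i \<and> i div e < n then coeff f (i + r) else 0)" for i
    proof -
      have "coeff H i = (\<Sum>q<n. if q = i div e \<and> e dvd i then coeff f (i + r) else 0)"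
        unfolding H_def coeff_sum by (rule sum.cong) (use e(1) in auto)
      also have "\<dots> = (if e dvd i \<and> i div e < n then coeff f (i + r) else 0)" by (cases "e dvd i") auto
      finally show ?thesis .
    qed
    have d0: "degree f > 0"
      using monic_root_degree_pos[OF _ f(3)] f(2) by (simp add: degree_rat_poly coeff_map_poly)
    have "degree H < degree f"
      using r d0 by (intro degree_lessI) (auto simp: coeffH coeff_eq_0)
    moreover have "poly (rat_poly H) \<alpha> = c r"
      unfolding H_def c_def
      by (induction n) (simp_all add: rat_poly_add rat_poly_monom poly_monom coeff_map_poly power_mult mult.commute[of _ e])
    ultimately have "H = 0" using irreducible_root_degree_less[OF f(1,3), of H] c0[OF r(2)] by simp
    show ?thesis
    proof (cases "j \<le> degree f")
      case True
      define i where "i = j div e * e"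
      have "j div e \<le> degree f" using True div_le_dividend le_trans by blast
      hence "coeff H i = coeff f (i + r)" using coeffH[of i] e(1) by (simp add: i_def n_def)
      thus ?thesis using \<open>H = 0\<close> by (simp add: i_def r_def)
    qed (simp add: coeff_eq_0)
  qed
  have "card {z::complex. z ^ e = 1} = e" using e(1) by (rule card_roots_unity_eq)
  hence "\<not> {z::complex. z ^ e = 1} \<subseteq> {1}" using e2 card_mono[of "{1::complex}" "{z. z ^ e = 1}"] by auto
  then obtain \<zeta> :: complex where \<zeta>: "\<zeta> ^ e = 1" "\<zeta> \<noteq> 1" by auto
  define Z where "Z = {z :: complex. poly (rat_poly f) z = 0}"
  have "f \<noteq> 0" using f(2) by auto
  hence finZ: "finite Z" unfolding Z_def by (intro poly_roots_finite) (simp add: rat_poly_eq_0_iff)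
  have "poly (rat_poly f) (\<zeta> * z) = poly (rat_poly f) z" for z
    unfolding poly_altdef
  proof (rule sum.cong)
    fix j
    show "coeff (rat_poly f) j * (\<zeta> * z) ^ j = coeff (rat_poly f) j * z ^ j"
      using \<zeta>(1) by (cases "e dvd j") (auto simp: coeff_map_poly coeff0 power_mult_distrib power_mult elim: dvdE)
  qed simp
  hence "(\<lambda>z. \<zeta> * z) ` Z \<subseteq> Z" by (auto simp: Z_def)
  moreover have "\<zeta> \<noteq> 0" using \<zeta>(1) e(1) by (metis power_0_left neq0_conv zero_neq_one)
  hence inj: "inj_on (\<lambda>z. \<zeta> * z) Z" by (auto simp: inj_on_def)
  ultimately have Z: "(\<lambda>z. \<zeta> * z) ` Z = Z" by (intro endo_inj_surj finZ)
  \<comment> \<open>Exponents congruent to 1 suffice: the rotation multiplies such a sum by \<zeta>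
    itself, so \<zeta> \<noteq> 1 is enough and \<zeta> may be imprimitive.\<close>
  have "(\<Sum>z\<in>Z. z ^ (1 + e * k)) = 0" for k
  proof -
    have "(\<Sum>z\<in>Z. z ^ (1 + e * k)) = (\<Sum>z\<in>Z. (\<zeta> * z) ^ (1 + e * k))"
      by (subst Z[symmetric]) (simp add: sum.reindex[OF inj])
    also have "\<dots> = \<zeta> ^ (1 + e * k) * (\<Sum>z\<in>Z. z ^ (1 + e * k))"
      by (simp only: power_mult_distrib sum_distrib_left)
    also have "\<zeta> ^ (1 + e * k) = \<zeta>" using \<zeta>(1) by (simp add: power_mult)
    finally have "(1 - \<zeta>) * (\<Sum>z\<in>Z. z ^ (1 + e * k)) = 0" by (simp add: left_diff_distrib)
    thus ?thesis using \<zeta>(2) by simp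
  qed
  hence "range (\<lambda>k. 1 + e * k) \<subseteq> {n. (\<Sum>z\<in>Z. z ^ n) = 0}" by auto
  moreover have "infinite (range (\<lambda>k. 1 + e * k))"
    using e(1) by (intro range_inj_infinite) (auto simp: inj_def)
  ultimately show ?thesis unfolding Z_def by (rule infinite_super)
qed

text \<open>As 1 belongs to the group, finiteness is the whole content: \<open>card\<close> would be
  0 otherwise.\<close>

lemma card_torsion_units_splitting_field_pos:
  assumes "lead_coeff f = 1"
  shows "card (torsion_units (splitting_field f)) > 0"
proof -
  define Z where "Z = {z :: complex. poly (rat_poly f) z = 0}"
  have K: "is_subfield (splitting_field f)" unfolding splitting_field_def by (rule is_subfield_rat_adjoin)
  have "f \<noteq> 0" using assms by auto
  hence "finite Z" unfolding Z_def by (intro poly_roots_finite) (simp add: rat_poly_eq_0_iff)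
  moreover have "\<exists>P\<in>poly_over \<rat>. lead_coeff P = 1 \<and> poly P z = 0" if "z \<in> Z" for z
    using that assms by (intro bexI[of _ "rat_poly f"] rat_poly_over_Rats) (simp add: Z_def degree_rat_poly coeff_map_poly)
  ultimately obtain B where "finite B" "rat_adjoin Z \<subseteq> rat_vs.span B"
    using rat_adjoin_finite_span by blast
  hence "finite (torsion_units (splitting_field f))"
    unfolding Z_def splitting_field_def[symmetric]
    by (rule finite_roots_of_unity_in_finite_span[OF subring_of_subfield[OF K]])
  moreover have "1 \<in> torsion_units (splitting_field f)"
    using K by (auto simp: torsion_units_def is_subfield_def intro: exI[of _ 1])
  ultimately show ?thesis by (auto simp: card_gt_0_iff)
qed

theorem theorem1p9:
  fixes \<alpha> :: real and h :: nat
  assumes "algebraic \<alpha>" and "\<alpha> > 0"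
    and "h = card (torsion_units (splitting_field (rat_min_poly \<alpha>)))"
  shows "infinite {n::nat. field_trace (rat_adjoin {\<alpha>}) (\<alpha> ^ n) = 0}
           \<longleftrightarrow> \<alpha> \<notin> rat_adjoin {\<alpha> ^ h}"
proof -
  define f where "f = rat_min_poly \<alpha>"
  have f: "irreducible f" "lead_coeff f = 1" "poly (rat_poly f) \<alpha> = 0"
    unfolding f_def using rat_min_poly[OF assms(1)] by blast+
  have h: "h > 0" using card_torsion_units_splitting_field_pos[OF f(2)] by (simp add: assms(3) f_def)
  have "field_trace (rat_adjoin {\<alpha>}) (\<alpha> ^ n) = 0 \<longleftrightarrow> (\<Sum>z | poly (rat_poly f) z = 0. z ^ n :: complex) = 0" for n
    unfolding f_def of_rat_field_trace_power[OF assms(1), symmetric] by simp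
  hence eq: "{n. field_trace (rat_adjoin {\<alpha>}) (\<alpha> ^ n) = 0} =
      {n. (\<Sum>z | poly (rat_poly f) z = 0. z ^ n :: complex) = 0}" by simp
  show ?thesis unfolding eq
    using finite_power_sum_zeros[OF f _ assms(3)[folded f_def]] infinite_power_sum_zeros[OF f assms(2) h] assms(2)
    by blast
qed

end
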